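(* Consider, for every $m\in\mathbb{N}$, the model $y_m=A_mx_m^*+\varepsilon_m$ with $A_m\in\mathbb{R}^{m\times m}$, $x_m^*\in\mathbb{R}^m$ and $\varepsilon_m\sim\mathcal{N}(0,\sigma^2I_m)$, where $\sigma^2>0$ does not depend on $m$, and suppose that the singular values of $A_m$ satisfy $1=\gamma_{1,m}\ge\gamma_{2,m}\ge\dots\ge\gamma_{m,m}\ge 0$. Let $x_{i,m}^*$ denote the coefficients of $x_m^*$ with respect to the right singular vectors of $A_m$. Let $\max_{1\le i\le m}|x_{i,m}^*|$ be uniformly bounded in $m$ and let $\frac1m\sum_{i=1}^m\gamma_{i,m}^4(x_{i,m}^* )^2$ be uniformly bounded away from zero. Then there exists a subsequence $\hat\alpha_{\mathrm{MSPE},m_k}$ of the minimizers $\hat\alpha_{\mathrm{MSPE},m}$ of $\mathrm{MSPE}_m$ that converges to a minimizer of the asymptotic risk $f$. Moreover, $\hat\alpha_{\mathrm{PSURE},m_k}$ converges to a minimizer of the asymptotic risk $f$ in probability.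
   Context: Tikhonov estimator: for $\alpha>0$, $\hat x_\alpha(y)=(A_m^{T}A_m+\alpha I)^{-1}A_m^{T}y$; for $\alpha=0$ all quantities are understood as limits $\alpha\downarrow0$. Singular system: $A_m=U\Sigma V^{T}$, $\Sigma=\mathrm{diag}(\gamma_{1,m},\dots,\gamma_{m,m})$, $u_i,v_i$ the columns of the orthogonal matrices $U,V$; $y_i=\langle u_i,y\rangle$, $x_{i,m}^*=\langle v_i,x_m^*\rangle$. Mean squared prediction error: $\mathrm{MSPE}_m(\alpha)=\mathbb{E}\bigl[\|A_m(x_m^*-\hat x_\alpha(y_m))\|_2^2\bigr]$; $\hat\alpha_{\mathrm{MSPE},m}$ denotes its minimizer over $\alpha\ge0$. Risk estimator: $$\mathrm{PSURE}_m(\alpha,y)=\|y-A_m\hat x_\alpha(y)\|_2^2-m\sigma^2+2\sigma^2\,\mathrm{tr}\bigl(A_m(A_m^{T}A_m+\alpha I)^{-1}A_m^{T}\bigr)=\sum_{i=1}^m\frac{\alpha^2}{(\gamma_{i,m}^2+\alpha)^2}y_i^2-m\sigma^2+2\sigma^2\sum_{i=1}^m\frac{\gamma_{i,m}^2}{\gamma_{i,m}^2+\alpha};$$ $\hat\alpha_{\mathrm{PSURE},m}\in\mathrm{argmin}_{\alpha\ge0}\,\mathrm{PSURE}_m(\alpha,y_m)$, which is a random variable. Asymptotic risk: $f$ is the continuous limit function of a subsequence $f_{m_k}$ of the functions $f_m:\alpha\mapsto\frac1m\mathrm{MSPE}_m(\alpha)$ that converges uniformly on sets $[C_1,C_2]$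 with $0<C_1<C_2$; the indices $m_k$ in the claim refer to such a subsequence.
   Formalization: PSURE minimizers are shown to converge in probability to the set of minimizers of f (distance tends to 0), as a single limit can fail when f has several minimizers; they need to minimize PSURE only when a minimizer exists, since with positive probability there may be none. *)

theory Defs
  imports
    "HOL-Probability.Probability"
    "Jordan_Normal_Form.Gauss_Jordan_Elimination"
begin

(* Matrices and vectors are those of Jordan_Normal_Form, because the dimension m
   runs through the natural numbers. *)
no_notation inner (infix "\<bullet>" 70)
no_notation Finite_Cartesian_Product.vec_nth (infixl "$" 90)

definition vec_norm2 :: "real vec \<Rightarrow> real" where
  "vec_norm2 v = sqrt (v \<bullet> v)"

definition mat_trace :: "real mat \<Rightarrow> real" where
  "mat_trace B = (\<Sum>i<dim_row B. B $$ (i, i))"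

(* Singular vectors are the columns of U and V. Indices start at 0, so the largest
   singular value is \<gamma> 0. *)
definition singular_system ::
  "nat \<Rightarrow> real mat \<Rightarrow> real mat \<Rightarrow> (nat \<Rightarrow> real) \<Rightarrow> real mat \<Rightarrow> bool" where
  "singular_system m A U \<gamma> V \<longleftrightarrow>
     A \<in> carrier_mat m m \<and> U \<in> carrier_mat m m \<and> V \<in> carrier_mat m m \<and>
     transpose_mat U * U = 1\<^sub>m m \<and> transpose_mat V * V = 1\<^sub>m m \<and>
     A = U * mat_diag m \<gamma> * transpose_mat V \<and>
     (\<forall>i<m. 0 \<le> \<gamma> i) \<and> (\<forall>i j. i \<le> j \<and> j < m \<longrightarrow> \<gamma> j \<le> \<gamma> i)"

(* The law N(0, \<sigma>^2 I_m): m independent N(0, \<sigma>^2) components.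
   The second argument of normal_density is the standard deviation. *)
definition gaussian_noise :: "'a measure \<Rightarrow> nat \<Rightarrow> real \<Rightarrow> ('a \<Rightarrow> real vec) \<Rightarrow> bool" where
  "gaussian_noise M m \<sigma> e \<longleftrightarrow>
     (\<forall>\<omega>\<in>space M. e \<omega> \<in> carrier_vec m) \<and>
     prob_space.indep_vars M (\<lambda>_. borel) (\<lambda>i \<omega>. e \<omega> $ i) {..<m} \<and>
     (\<forall>i<m. distributed M lborel (\<lambda>\<omega>. e \<omega> $ i) (normal_density 0 \<sigma>))"

(* (A^T A + \<alpha> I)^{-1} A^T. It is meant for \<alpha> > 0, where the inverse exists and
   mat_inverse is not None. *)
definition tikhonov_mat :: "real mat \<Rightarrow> real \<Rightarrow> real mat" where
  "tikhonov_mat A \<alpha> =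
     the (mat_inverse (transpose_mat A * A + \<alpha> \<cdot>\<^sub>m 1\<^sub>m (dim_col A))) * transpose_mat A"

definition tikhonov :: "real mat \<Rightarrow> real \<Rightarrow> real vec \<Rightarrow> real vec" where
  "tikhonov A \<alpha> y = tikhonov_mat A \<alpha> *\<^sub>v y"

(* Quantities depending on \<alpha> are given by a formula for \<alpha> > 0; their value at
   \<alpha> = 0 is the limit as \<alpha> decreases to 0. *)
definition ext_zero :: "(real \<Rightarrow> real) \<Rightarrow> real \<Rightarrow> real" where
  "ext_zero g \<alpha> = (if \<alpha> = 0 then Lim (at_right 0) g else g \<alpha>)"

definition mspe :: "'a measure \<Rightarrow> real mat \<Rightarrow> real vec \<Rightarrow> ('a \<Rightarrow> real vec) \<Rightarrow> real \<Rightarrow> real" where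
  "mspe M A x y =
     ext_zero (\<lambda>\<alpha>. \<integral>\<omega>. (vec_norm2 (A *\<^sub>v (x - tikhonov A \<alpha> (y \<omega>))))\<^sup>2 \<partial>M)"

definition psure :: "real mat \<Rightarrow> real \<Rightarrow> real vec \<Rightarrow> real \<Rightarrow> real" where
  "psure A \<sigma> y =
     ext_zero (\<lambda>\<alpha>. (vec_norm2 (y - A *\<^sub>v tikhonov A \<alpha> y))\<^sup>2 - real (dim_row A) * \<sigma>\<^sup>2
       + 2 * \<sigma>\<^sup>2 * mat_trace (A * tikhonov_mat A \<alpha>))"

(* Here R m is the unscaled risk in dimension m; f is its asymptotic version, a function on
   the positive reals, obtained along the subsequence r. *)
definition asymptotic_risk ::
  "(nat \<Rightarrow> real \<Rightarrow> real) \<Rightarrow> (nat \<Rightarrow> nat) \<Rightarrow> (real \<Rightarrow> real) \<Rightarrow> bool" where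
  "asymptotic_risk R r f \<longleftrightarrow>
     strict_mono r \<and> continuous_on {0<..} f \<and>
     (\<forall>C1 C2. 0 < C1 \<and> C1 < C2 \<longrightarrow>
        uniform_limit {C1..C2} (\<lambda>k \<alpha>. R (r k) \<alpha> / real (r k)) f sequentially)"

(* Convergence in probability to the set S: the probability that X k has distance at least
   \<delta> from S tends to 0. For S = {a} this is convergence in probability to a. For empty S
   the event is the whole space, so the property fails. *)
definition converges_in_prob_to_set ::
  "(nat \<Rightarrow> 'a measure) \<Rightarrow> (nat \<Rightarrow> 'a \<Rightarrow> real) \<Rightarrow> real set \<Rightarrow> bool" where
  "converges_in_prob_to_set M X S \<longleftrightarrow>
     (\<forall>\<delta>>0. (\<lambda>k. measure (M k) {\<omega> \<in> space (M k). \<forall>a\<in>S. \<delta> \<le> \<bar>X k \<omega> - a\<bar>})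
        \<longlonglongrightarrow> 0)"

end

theory Submission
  imports Defs "Jordan_Normal_Form.Determinant" "HOL-Complex_Analysis.Great_Picard"
    "HOL-Library.Diagonal_Subsequence"
begin

text \<open>In the singular bases the risk is
  \<open>\<Sum>i (1 - u\<^sub>i)\<^sup>2 \<gamma>\<^sub>i\<^sup>2 x\<^sub>i\<^sup>2 + \<sigma>\<^sup>2 u\<^sub>i\<^sup>2\<close> with \<open>u\<^sub>i = \<gamma>\<^sub>i\<^sup>2 / (\<gamma>\<^sub>i\<^sup>2 + \<alpha>)\<close>. Its derivative
  \<open>2 \<Sum>i \<gamma>\<^sub>i\<^sup>4 (\<alpha> x\<^sub>i\<^sup>2 - \<sigma>\<^sup>2) / (\<gamma>\<^sub>i\<^sup>2 + \<alpha>)\<^sup>3\<close> is, per dimension, bounded away from zero near \<open>\<alpha> = 0\<close>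
  (negative) and eventually positive, uniformly in the dimension; so all minimizers lie in one
  compact interval of positive reals and pass to the limit. The risk estimator differs from the
  risk by \<open>\<Sum>i (1 - u\<^sub>i)\<^sup>2 (y\<^sub>i\<^sup>2 - E y\<^sub>i\<^sup>2)\<close>. For every \<open>\<alpha>\<close> the weights are monotone in \<open>i\<close>, so by
  Abel summation the difference is bounded, simultaneously for all \<open>\<alpha>\<close>, by the largest partial sum
  of \<open>y\<^sub>i\<^sup>2 - E y\<^sub>i\<^sup>2\<close>, which Chebyshev's inequality on a finite grid shows to be of order
  \<open>o(m)\<close> in probability.\<close>

section \<open>Singular value calculus\<close>

text \<open>The minimizer of the risk estimator is random and may lie anywhere in the closed half
  line, so a law of large numbers at each fixed \<alpha> does not reach it. Nor does a union bound
  over all m partial sums: at a level proportional to m, Chebyshev gives each one probability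
  O(1/m), hence only O(1) in total. With a number of grid points that depends on the tolerance but
  not on m, the total is O(1/m), and the gaps of the grid are filled by the positivity of the
  squares. The lower bound on the mean of \<open>\<gamma>^4 x^2\<close> works at both ends: near 0
  the boundedness of x turns it into a lower bound on the sum of \<open>\<gamma>^4\<close>, where
  the variance decreases faster than the bias grows; for large \<alpha> it is the growth of the bias
  itself. All gaps are proportional to m, so a perturbation of order o(m) cannot move a minimizer
  across them. As f may have several minimizers, the estimator is compared with the whole set of
  them. A minimizer of the estimator is only assumed to be selected where one exists; its existence
  is proved on the event of small deviation.\<close>

definition sandwich :: "nat \<Rightarrow> real mat \<Rightarrow> (nat \<Rightarrow> real) \<Rightarrow> real mat \<Rightarrow> real mat" where
  "sandwich m P f Q = P * mat_diag m f * transpose_mat Q"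

definition orthonormal_mat :: "nat \<Rightarrow> real mat \<Rightarrow> bool" where
  "orthonormal_mat m P \<longleftrightarrow> P \<in> carrier_mat m m \<and> transpose_mat P * P = 1\<^sub>m m"

lemma orthonormal_mat_carrier: "orthonormal_mat m P \<Longrightarrow> P \<in> carrier_mat m m"
  by (simp add: orthonormal_mat_def)

lemma orthonormal_mat_right_inverse:
  assumes "orthonormal_mat m P" shows "P * transpose_mat P = 1\<^sub>m m"
  using assms mat_mult_left_right_inverse[of "transpose_mat P" m P]
  by (simp add: orthonormal_mat_def)

lemma orthonormal_mat_col_inner:
  assumes "orthonormal_mat m P" "i < m" "j < m"
  shows "(\<Sum>a<m. P $$ (a, i) * P $$ (a, j)) = (if i = j then 1 else 0)"
proof -
  have P: "P \<in> carrier_mat m m" and PP: "transpose_mat P * P = 1\<^sub>m m"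
    using assms(1) by (auto simp: orthonormal_mat_def)
  have "(transpose_mat P * P) $$ (i, j) = (\<Sum>a<m. P $$ (a, i) * P $$ (a, j))"
    using P assms(2,3) by (simp add: scalar_prod_def lessThan_atLeast0)
  then show ?thesis using PP assms(2,3) by simp
qed

lemma sandwich_carrier:
  "P \<in> carrier_mat m m \<Longrightarrow> Q \<in> carrier_mat m m \<Longrightarrow> sandwich m P f Q \<in> carrier_mat m m"
  by (simp add: sandwich_def mult_carrier_mat[of _ m m _ m])

lemma sandwich_index:
  assumes "P \<in> carrier_mat m m" "Q \<in> carrier_mat m m" "i < m" "j < m"
  shows "sandwich m P f Q $$ (i, j) = (\<Sum>k<m. P $$ (i, k) * f k * Q $$ (j, k))"
proof -
  have "P * mat_diag m f = Matrix.mat m m (\<lambda>(i, j). P $$ (i, j) * f j)"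
    using assms by (simp add: mat_diag_mult_right)
  then show ?thesis
    using assms by (simp add: sandwich_def scalar_prod_def lessThan_atLeast0)
qed

text \<open>The inner factor \<open>transpose_mat Q * Q\<close> cancels. Products, shifts by
  multiples of the identity and inverses thus become pointwise operations on the spectra, which is
  all the matrix algebra needed for the Tikhonov formula.\<close>

lemma sandwich_mult:
  assumes "P \<in> carrier_mat m m" "orthonormal_mat m Q" "R \<in> carrier_mat m m"
  shows "sandwich m P f Q * sandwich m Q g R = sandwich m P (\<lambda>i. f i * g i) R"
proof -
  have Q: "Q \<in> carrier_mat m m" "transpose_mat Q * Q = 1\<^sub>m m"
    using assms(2) by (auto simp: orthonormal_mat_def)
  let ?F = "mat_diag m f" and ?G = "mat_diag m g"
  have 1: "?G * transpose_mat R \<in> carrier_mat m m"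
    using assms by (intro mult_carrier_mat[of _ m m]) auto
  have "transpose_mat Q * (Q * (?G * transpose_mat R)) = (transpose_mat Q * Q) * (?G * transpose_mat R)"
    using Q(1) 1 by (intro assoc_mult_mat[symmetric]) auto
  also have "\<dots> = ?G * transpose_mat R" unfolding Q(2) by (rule left_mult_one_mat[OF 1])
  finally have 2: "transpose_mat Q * (Q * (?G * transpose_mat R)) = ?G * transpose_mat R" .
  have "sandwich m P f Q * sandwich m Q g R
      = P * (?F * (transpose_mat Q * (Q * (?G * transpose_mat R))))"
    using assms(1,3) Q(1) unfolding sandwich_def
    by (simp add: assoc_mult_mat[of _ m m _ m _ m] mult_carrier_mat[of _ m m _ m])
  also have "\<dots> = P * ((?F * ?G) * transpose_mat R)"
    unfolding 2 using assms(3) by (subst assoc_mult_mat[of _ m m _ m _ m]) auto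
  also have "\<dots> = sandwich m P (\<lambda>i. f i * g i) R"
    using assms(1,3) unfolding sandwich_def mat_diag_diag[symmetric]
    by (simp add: assoc_mult_mat[of _ m m _ m _ m] mult_carrier_mat[of _ m m _ m] del: mat_diag_diag)
  finally show ?thesis .
qed

lemma transpose_sandwich:
  assumes "P \<in> carrier_mat m m" "Q \<in> carrier_mat m m"
  shows "transpose_mat (sandwich m P f Q) = sandwich m Q f P"
proof (rule eq_matI)
  fix i j assume "i < dim_row (sandwich m Q f P)" "j < dim_col (sandwich m Q f P)"
  then have "i < m" "j < m" using sandwich_carrier[of Q m P f] assms by auto
  then show "transpose_mat (sandwich m P f Q) $$ (i, j) = sandwich m Q f P $$ (i, j)"
    using assms sandwich_carrier[of P m Q f] by (simp add: sandwich_index mult.commute mult.left_commute)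
qed (use assms sandwich_carrier[of P m Q f] sandwich_carrier[of Q m P f] in auto)

lemma sandwich_one:
  assumes "orthonormal_mat m P" shows "sandwich m P (\<lambda>_. 1) P = 1\<^sub>m m"
  using assms orthonormal_mat_right_inverse[OF assms]
  by (simp add: sandwich_def orthonormal_mat_def right_mult_one_mat[of _ m m])

lemma sandwich_add_smult_one:
  assumes "orthonormal_mat m P"
  shows "sandwich m P f P + \<alpha> \<cdot>\<^sub>m 1\<^sub>m m = sandwich m P (\<lambda>i. f i + \<alpha>) P"
proof -
  have P: "P \<in> carrier_mat m m" using assms by (simp add: orthonormal_mat_def)
  show ?thesis unfolding sandwich_one[OF assms, symmetric]
  proof (rule eq_matI)
    fix i j assume "i < dim_row (sandwich m P (\<lambda>i. f i + \<alpha>) P)" "j < dim_col (sandwich m P (\<lambda>i. f i + \<alpha>) P)"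
    then have "i < m" "j < m" using sandwich_carrier[OF P P, of "\<lambda>i. f i + \<alpha>"] by auto
    then show "(sandwich m P f P + \<alpha> \<cdot>\<^sub>m sandwich m P (\<lambda>_. 1) P) $$ (i, j)
        = sandwich m P (\<lambda>i. f i + \<alpha>) P $$ (i, j)"
      using sandwich_carrier[OF P P, of f] sandwich_carrier[OF P P, of "\<lambda>_. 1"]
      by (simp add: sandwich_index[OF P P] sum_distrib_left sum.distrib[symmetric] algebra_simps)
  qed (use sandwich_carrier[OF P P, of "\<lambda>_. 1"] sandwich_carrier[OF P P, of "\<lambda>i. f i + \<alpha>"] in auto)
qed

text \<open>After exchanging the sums, each spectral value is multiplied by the squared norm of a
  column of \<open>P\<close>, which is 1.\<close>

lemma mat_trace_sandwich:
  assumes "orthonormal_mat m P"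
  shows "mat_trace (sandwich m P f P) = (\<Sum>i<m. f i)"
proof -
  have P: "P \<in> carrier_mat m m" using assms by (simp add: orthonormal_mat_def)
  have "mat_trace (sandwich m P f P) = (\<Sum>i<m. \<Sum>k<m. P $$ (i, k) * f k * P $$ (i, k))"
    unfolding mat_trace_def using sandwich_carrier[OF P P, of f]
    by (auto simp: sandwich_index[OF P P] intro!: sum.cong)
  also have "\<dots> = (\<Sum>k<m. f k * (\<Sum>i<m. P $$ (i, k) * P $$ (i, k)))"
    by (subst sum.swap) (simp add: sum_distrib_left algebra_simps)
  also have "\<dots> = (\<Sum>k<m. f k)" using orthonormal_mat_col_inner[OF assms] by simp
  finally show ?thesis .
qed

lemma sandwich_mult_vec:
  assumes "P \<in> carrier_mat m m" "Q \<in> carrier_mat m m" "w \<in> carrier_vec m"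
  shows "sandwich m P f Q *\<^sub>v w = P *\<^sub>v Matrix.vec m (\<lambda>i. f i * (col Q i \<bullet> w))"
proof -
  have "mat_diag m f *\<^sub>v (transpose_mat Q *\<^sub>v w) = Matrix.vec m (\<lambda>i. f i * (col Q i \<bullet> w))"
  proof (rule eq_vecI)
    fix i assume "i < dim_vec (Matrix.vec m (\<lambda>i. f i * (col Q i \<bullet> w)))"
    then have i: "i < m" by simp
    then have "(mat_diag m f *\<^sub>v (transpose_mat Q *\<^sub>v w)) $ i
        = (\<Sum>j\<in>{0..<m}. (if i = j then f j else 0) * (col Q j \<bullet> w))"
      using assms by (simp add: mat_diag_def scalar_prod_def[of "Matrix.vec _ _"])
    also have "\<dots> = (\<Sum>j\<in>{0..<m}. if i = j then f j * (col Q j \<bullet> w) else 0)"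
      by (intro sum.cong) auto
    also have "\<dots> = f i * (col Q i \<bullet> w)" using i by simp
    finally show "(mat_diag m f *\<^sub>v (transpose_mat Q *\<^sub>v w)) $ i
        = Matrix.vec m (\<lambda>i. f i * (col Q i \<bullet> w)) $ i" using i by simp
  qed (simp add: mat_diag_def)
  then show ?thesis using assms unfolding sandwich_def by (simp add: assoc_mult_mat_vec[of _ m m _ m])
qed

lemma vec_norm2_square: "(vec_norm2 v)\<^sup>2 = (\<Sum>i<dim_vec v. (v $ i)\<^sup>2)"
  unfolding vec_norm2_def
  by (subst real_sqrt_pow2)
     (auto simp: scalar_prod_def lessThan_atLeast0 power2_eq_square intro!: sum_nonneg)

lemma vec_norm2_orthogonal:
  assumes "orthonormal_mat m P" "z \<in> carrier_vec m"
  shows "(vec_norm2 (P *\<^sub>v z))\<^sup>2 = (\<Sum>i<m. (z $ i)\<^sup>2)"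
proof -
  have P: "P \<in> carrier_mat m m" "transpose_mat P * P = 1\<^sub>m m"
    using assms by (auto simp: orthonormal_mat_def)
  have "(P *\<^sub>v z) \<bullet> (P *\<^sub>v z) = (transpose_mat P *\<^sub>v (P *\<^sub>v z)) \<bullet> z"
    using P assms(2) by (intro transpose_vec_mult_scalar[symmetric]) auto
  also have "transpose_mat P *\<^sub>v (P *\<^sub>v z) = z"
    using P assms(2) by (subst assoc_mult_mat_vec[symmetric, of _ m m _ m]) auto
  finally have "vec_norm2 (P *\<^sub>v z) = vec_norm2 z" by (simp add: vec_norm2_def)
  then show ?thesis using vec_norm2_square[of z] assms(2) by simp
qed

lemma orthonormal_mat_expand:
  assumes "orthonormal_mat m P" "w \<in> carrier_vec m"
  shows "w = P *\<^sub>v Matrix.vec m (\<lambda>i. col P i \<bullet> w)"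
  using sandwich_mult_vec[of P m P w "\<lambda>_. 1"] assms
  by (simp add: sandwich_one orthonormal_mat_carrier)

lemma col_orthogonal_mult_vec:
  assumes "orthonormal_mat m P" "z \<in> carrier_vec m" "i < m"
  shows "col P i \<bullet> (P *\<^sub>v z) = z $ i"
proof -
  have P: "P \<in> carrier_mat m m" "transpose_mat P * P = 1\<^sub>m m"
    using assms by (auto simp: orthonormal_mat_def)
  have "col P i \<bullet> (P *\<^sub>v z) = (transpose_mat P *\<^sub>v (P *\<^sub>v z)) $ i"
    using P assms by simp
  also have "transpose_mat P *\<^sub>v (P *\<^sub>v z) = z"
    using P assms(2) by (subst assoc_mult_mat_vec[symmetric, of _ m m _ m]) auto
  finally show ?thesis .
qed

text \<open>For square matrices a right inverse is also a left inverse. So \<open>B\<close> is a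
  unit of the matrix ring, which rules out the result \<open>None\<close>, and uniqueness of
  inverses identifies the result with \<open>C\<close>.\<close>

lemma the_mat_inverse:
  fixes B C :: "real mat"
  assumes B: "B \<in> carrier_mat m m" and C: "C \<in> carrier_mat m m" and BC: "B * C = 1\<^sub>m m"
  shows "the (mat_inverse B) = C"
proof (cases "mat_inverse B")
  case None
  have "C * B = 1\<^sub>m m" using mat_mult_left_right_inverse[OF B C BC] .
  then have "B \<in> Units (ring_mat TYPE(real) m ())"
    using B C BC unfolding Units_def ring_mat_def by auto
  then show ?thesis using mat_inverse(1)[OF B None, of "()"] by contradiction
next
  case (Some D)
  then have D: "D * B = 1\<^sub>m m" "D \<in> carrier_mat m m" using mat_inverse(2)[OF B] by auto
  have "D = D * (B * C)" using D BC by simp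
  also have "\<dots> = (D * B) * C" using B C D(2) by (simp add: assoc_mult_mat[of _ m m _ m _ m])
  also have "\<dots> = C" using D(1) C by simp
  finally show ?thesis using Some by simp
qed

text \<open>The filter factor of Tikhonov regularization: the eigenvalue, along a left singular
  vector with singular value \<open>g\<close>, of the matrix that maps data to fitted data.\<close>

definition shrinkage :: "real \<Rightarrow> real \<Rightarrow> real" where
  "shrinkage g \<alpha> = g\<^sup>2 / (g\<^sup>2 + \<alpha>)"

section \<open>Tikhonov estimator, prediction error and residual in the singular bases\<close>

context
  fixes m :: nat and A U V :: "real mat" and \<gamma> :: "nat \<Rightarrow> real"
  assumes svd: "singular_system m A U \<gamma> V"
begin

lemma singular_system_facts:
  "orthonormal_mat m U" "orthonormal_mat m V" "U \<in> carrier_mat m m" "V \<in> carrier_mat m m"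
  "A \<in> carrier_mat m m" "A = sandwich m U \<gamma> V"
  using svd by (auto simp: singular_system_def orthonormal_mat_def sandwich_def)

lemma tikhonov_mat_svd:
  assumes "0 < \<alpha>"
  shows "tikhonov_mat A \<alpha> = sandwich m V (\<lambda>i. \<gamma> i / ((\<gamma> i)\<^sup>2 + \<alpha>)) U"
proof -
  note f = singular_system_facts
  have tA: "transpose_mat A = sandwich m V \<gamma> U" using f transpose_sandwich by metis
  have AA: "transpose_mat A * A + \<alpha> \<cdot>\<^sub>m 1\<^sub>m (dim_col A) = sandwich m V (\<lambda>i. \<gamma> i * \<gamma> i + \<alpha>) V"
    using f(5) unfolding tA by (subst f(6)) (simp add: sandwich_mult[OF f(4,1,4)] sandwich_add_smult_one[OF f(2)])
  have nz: "\<gamma> i * \<gamma> i + \<alpha> \<noteq> 0" for i using assms by (smt (verit) zero_le_square)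
  have "the (mat_inverse (sandwich m V (\<lambda>i. \<gamma> i * \<gamma> i + \<alpha>) V)) = sandwich m V (\<lambda>i. 1 / (\<gamma> i * \<gamma> i + \<alpha>)) V"
    by (rule the_mat_inverse) (use nz in \<open>simp_all add: sandwich_carrier[OF f(4,4)] sandwich_mult[OF f(4,2,4)] sandwich_one[OF f(2)]\<close>)
  then show ?thesis unfolding tikhonov_mat_def AA unfolding tA
    by (simp add: sandwich_mult[OF f(4,2,3)] power2_eq_square)
qed

lemma forward_tikhonov_mat_svd:
  assumes "0 < \<alpha>"
  shows "A * tikhonov_mat A \<alpha> = sandwich m U (\<lambda>i. shrinkage (\<gamma> i) \<alpha>) U"
  using singular_system_facts unfolding tikhonov_mat_svd[OF assms]
  by (subst singular_system_facts(6))
     (simp add: sandwich_mult shrinkage_def power2_eq_square)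

lemma forward_tikhonov_svd:
  assumes "0 < \<alpha>" "w \<in> carrier_vec m"
  shows "A *\<^sub>v tikhonov A \<alpha> w = U *\<^sub>v Matrix.vec m (\<lambda>i. shrinkage (\<gamma> i) \<alpha> * (col U i \<bullet> w))"
proof -
  have "tikhonov_mat A \<alpha> \<in> carrier_mat m m"
    unfolding tikhonov_mat_svd[OF assms(1)] using singular_system_facts by (intro sandwich_carrier)
  then have "A *\<^sub>v tikhonov A \<alpha> w = (A * tikhonov_mat A \<alpha>) *\<^sub>v w"
    unfolding tikhonov_def using singular_system_facts(5) assms(2)
    by (intro assoc_mult_mat_vec[symmetric, of _ m m _ m])
  then show ?thesis
    unfolding forward_tikhonov_mat_svd[OF assms(1)]
    using sandwich_mult_vec singular_system_facts assms by simp
qed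

lemma col_data:
  assumes "x \<in> carrier_vec m" "e \<in> carrier_vec m" "i < m"
  shows "col U i \<bullet> (A *\<^sub>v x + e) = \<gamma> i * (col V i \<bullet> x) + col U i \<bullet> e"
proof -
  note f = singular_system_facts
  have "col U i \<bullet> (A *\<^sub>v x) = \<gamma> i * (col V i \<bullet> x)"
    using f assms by (subst f(6)) (simp add: sandwich_mult_vec col_orthogonal_mult_vec)
  then show ?thesis using f assms by (subst scalar_prod_add_distrib[of _ m]) auto
qed

text \<open>\<open>U\<close> preserves the norm, so the error can be read off its coefficients along
  the left singular vectors. Each coefficient is a bias, shrunk from the exact data, minus a
  shrunken noise coefficient.\<close>

lemma prediction_error_svd:
  assumes "0 < \<alpha>" "x \<in> carrier_vec m" "e \<in> carrier_vec m"
  shows "(vec_norm2 (A *\<^sub>v (x - tikhonov A \<alpha> (A *\<^sub>v x + e))))\<^sup>2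
    = (\<Sum>i<m. ((1 - shrinkage (\<gamma> i) \<alpha>) * (\<gamma> i * (col V i \<bullet> x))
               - shrinkage (\<gamma> i) \<alpha> * (col U i \<bullet> e))\<^sup>2)"
proof -
  note f = singular_system_facts
  let ?y = "A *\<^sub>v x + e"
  have y: "?y \<in> carrier_vec m" using f assms by auto
  have T: "tikhonov A \<alpha> ?y \<in> carrier_vec m"
    unfolding tikhonov_def tikhonov_mat_svd[OF assms(1)] using sandwich_carrier[OF f(4,3)] y by (intro mult_mat_vec_carrier) auto
  have Ax: "A *\<^sub>v x = U *\<^sub>v Matrix.vec m (\<lambda>i. \<gamma> i * (col V i \<bullet> x))"
    using f assms by (subst f(6)) (simp add: sandwich_mult_vec)
  have "A *\<^sub>v (x - tikhonov A \<alpha> ?y) = A *\<^sub>v x - A *\<^sub>v tikhonov A \<alpha> ?y"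
    using f T assms by (intro mult_minus_distrib_mat_vec) auto
  also have "\<dots> = U *\<^sub>v (Matrix.vec m (\<lambda>i. \<gamma> i * (col V i \<bullet> x))
      - Matrix.vec m (\<lambda>i. shrinkage (\<gamma> i) \<alpha> * (col U i \<bullet> ?y)))"
    unfolding forward_tikhonov_svd[OF assms(1) y] unfolding Ax using f by (intro mult_minus_distrib_mat_vec[symmetric]) auto
  finally show ?thesis
    by (simp add: vec_norm2_orthogonal[OF f(1)] col_data[OF assms(2,3)])
       (intro sum.cong arg_cong[of _ _ power2] refl, simp add: algebra_simps)
qed

lemma residual_svd:
  assumes "0 < \<alpha>" "w \<in> carrier_vec m"
  shows "(vec_norm2 (w - A *\<^sub>v tikhonov A \<alpha> w))\<^sup>2
    = (\<Sum>i<m. ((1 - shrinkage (\<gamma> i) \<alpha>) * (col U i \<bullet> w))\<^sup>2)"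
proof -
  note f = singular_system_facts
  have "w - A *\<^sub>v tikhonov A \<alpha> w = U *\<^sub>v Matrix.vec m (\<lambda>i. col U i \<bullet> w)
      - U *\<^sub>v Matrix.vec m (\<lambda>i. shrinkage (\<gamma> i) \<alpha> * (col U i \<bullet> w))"
    using orthonormal_mat_expand[OF f(1) assms(2)] forward_tikhonov_svd[OF assms] by simp
  also have "\<dots> = U *\<^sub>v (Matrix.vec m (\<lambda>i. col U i \<bullet> w)
      - Matrix.vec m (\<lambda>i. shrinkage (\<gamma> i) \<alpha> * (col U i \<bullet> w)))"
    using f by (intro mult_minus_distrib_mat_vec[symmetric]) auto
  finally show ?thesis
    by (simp add: vec_norm2_orthogonal[OF f(1)])
       (intro sum.cong arg_cong[of _ _ power2] refl, simp add: algebra_simps)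
qed

end

section \<open>Moments of Gaussian noise in an orthonormal basis\<close>

lemma (in prob_space) normal_linear_combination:
  assumes "0 < \<sigma>" "indep_vars (\<lambda>_. borel) X {..<m::nat}"
    and "\<And>i. i < m \<Longrightarrow> distributed M lborel (X i) (normal_density 0 \<sigma>)"
    and pos: "0 < (\<Sum>i<m. (c i)\<^sup>2)"
  shows "distributed M lborel (\<lambda>\<omega>. \<Sum>i<m. c i * X i \<omega>)
    (normal_density 0 (\<sigma> * sqrt (\<Sum>i<m. (c i)\<^sup>2)))"
proof -
  \<comment> \<open>Indices with coefficient 0 are dropped: the corresponding summand is constant
    and has no normal density, while the rule for sums of independent normal variables asks for
    positive deviations and a nonempty index set.\<close>
  define I where "I = {i. i < m \<and> c i \<noteq> 0}"
  have I: "finite I" "I \<subseteq> {..<m}" by (auto simp: I_def)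
  have "I \<noteq> {}"
  proof
    assume "I = {}"
    then have "(\<Sum>i<m. (c i)\<^sup>2) = 0" by (intro sum.neutral) (auto simp: I_def)
    with pos show False by simp
  qed
  have 1: "indep_vars (\<lambda>_. borel) (\<lambda>i \<omega>. c i * X i \<omega>) I"
    by (rule indep_vars_compose2[where Y="\<lambda>i x. c i * x" and M'="\<lambda>_. borel"])
       (use indep_vars_subset[OF assms(2) I(2)] in auto)
  have 2: "distributed M lborel (\<lambda>\<omega>. c i * X i \<omega>) (normal_density 0 (\<bar>c i\<bar> * \<sigma>))" if "i \<in> I" for i
    using normal_density_affine[of "X i" 0 \<sigma> "c i" 0] assms(1,3) that by (simp add: I_def)
  have "distributed M lborel (\<lambda>\<omega>. \<Sum>i\<in>I. c i * X i \<omega>)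
      (normal_density (\<Sum>i\<in>I. 0) (sqrt (\<Sum>i\<in>I. (\<bar>c i\<bar> * \<sigma>)\<^sup>2)))"
    by (rule sum_indep_normal[OF I(1) \<open>I \<noteq> {}\<close> 1 _ 2]) (use assms(1) in \<open>auto simp: I_def\<close>)
  moreover have "(\<Sum>i\<in>I. c i * X i \<omega>) = (\<Sum>i<m. c i * X i \<omega>)" for \<omega>
    using I by (intro sum.mono_neutral_left) (auto simp: I_def)
  moreover have "(\<Sum>i\<in>I. (\<bar>c i\<bar> * \<sigma>)\<^sup>2) = \<sigma>\<^sup>2 * (\<Sum>i<m. (c i)\<^sup>2)"
    unfolding sum_distrib_left using I
    by (intro sum.mono_neutral_cong_left) (auto simp: I_def power_mult_distrib mult.commute)
  ultimately show ?thesis using assms(1) by (simp add: real_sqrt_mult)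
qed

text \<open>The fourth moment is needed because Chebyshev's inequality will be applied to sums of
  squares of the data.\<close>

lemma (in prob_space) centered_normal_moments:
  assumes "0 < \<tau>" and Z: "distributed M lborel Z (normal_density 0 \<tau>)"
  shows "has_bochner_integral M Z 0"
    and "has_bochner_integral M (\<lambda>\<omega>. (Z \<omega>)\<^sup>2) (\<tau>\<^sup>2)"
    and "has_bochner_integral M (\<lambda>\<omega>. (Z \<omega>) ^ 4) (3 * \<tau> ^ 4)"
proof -
  have *: "has_bochner_integral M (\<lambda>\<omega>. g (Z \<omega>)) v"
    if "has_bochner_integral lborel (\<lambda>x. normal_density 0 \<tau> x * g x) v" "g \<in> borel_measurable borel"
    for g v
    using that distributed_integrable[OF Z, of g] distributed_integral[OF Z, of g]
    by (auto simp: has_bochner_integral_iff)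
  show "has_bochner_integral M Z 0"
    using *[of "\<lambda>x. x" 0] normal_moment_odd[OF assms(1), of 0 0] by simp
  show "has_bochner_integral M (\<lambda>\<omega>. (Z \<omega>)\<^sup>2) (\<tau>\<^sup>2)"
    using *[of "\<lambda>x. x\<^sup>2" "\<tau>\<^sup>2"] normal_moment_even[OF assms(1), of 0 1] by simp
  show "has_bochner_integral M (\<lambda>\<omega>. (Z \<omega>) ^ 4) (3 * \<tau> ^ 4)"
    using *[of "\<lambda>x. x ^ 4" "3 * \<tau> ^ 4"] normal_moment_even[OF assms(1), of 0 2]
    by (simp add: fact_numeral power_divide)
qed

text \<open>These moments of linear combinations replace rotation invariance of the noise; the moments
  of products follow from them by polarization.\<close>

locale isotropic_noise = prob_space M for M :: "'a measure" +
  fixes m :: nat and s :: real and e :: "nat \<Rightarrow> 'a \<Rightarrow> real"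
  assumes lin1: "\<And>c. has_bochner_integral M (\<lambda>\<omega>. \<Sum>i<m. c i * e i \<omega>) 0"
    and lin2: "\<And>c. has_bochner_integral M (\<lambda>\<omega>. (\<Sum>i<m. c i * e i \<omega>)\<^sup>2) (s * (\<Sum>i<m. (c i)\<^sup>2))"
    and lin4: "\<And>c. has_bochner_integral M (\<lambda>\<omega>. (\<Sum>i<m. c i * e i \<omega>) ^ 4)
      (3 * s\<^sup>2 * (\<Sum>i<m. (c i)\<^sup>2)\<^sup>2)"
begin

lemma component_moments:
  assumes "i < m"
  shows "has_bochner_integral M (e i) 0" "has_bochner_integral M (\<lambda>\<omega>. (e i \<omega>)\<^sup>2) s"
    "has_bochner_integral M (\<lambda>\<omega>. (e i \<omega>) ^ 4) (3 * s\<^sup>2)"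
proof -
  let ?c = "\<lambda>l. if l = i then 1 else (0::real)"
  have 1: "(\<Sum>l<m. ?c l * e l \<omega>) = e i \<omega>" for \<omega>
  proof -
    have "(\<Sum>l<m. ?c l * e l \<omega>) = (\<Sum>l<m. if l = i then e l \<omega> else 0)"
      by (intro sum.cong) auto
    then show ?thesis using assms by simp
  qed
  have 2: "(\<Sum>l<m. (?c l)\<^sup>2) = 1"
  proof -
    have "(\<Sum>l<m. (?c l)\<^sup>2) = (\<Sum>l<m. if l = i then 1 else 0)"
      by (intro sum.cong) auto
    then show ?thesis using assms by simp
  qed
  show "has_bochner_integral M (e i) 0" "has_bochner_integral M (\<lambda>\<omega>. (e i \<omega>)\<^sup>2) s"
    "has_bochner_integral M (\<lambda>\<omega>. (e i \<omega>) ^ 4) (3 * s\<^sup>2)"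
    using lin1[of ?c] lin2[of ?c] lin4[of ?c] unfolding 1 2 by simp_all
qed

lemma component_measurable [measurable]: "i < m \<Longrightarrow> e i \<in> borel_measurable M"
  using component_moments(1)[of i] by (auto simp: has_bochner_integral_iff)

text \<open>This is the value for independent coordinates, so distinct squares are uncorrelated. The
  identity used is \<open>12 a^2 b^2 = (a + b)^4 + (a - b)^4 - 2 a^4 - 2 b^4\<close>.\<close>

lemma product_moment:
  assumes "i < m" "j < m" "i \<noteq> j"
  shows "has_bochner_integral M (\<lambda>\<omega>. (e i \<omega>)\<^sup>2 * (e j \<omega>)\<^sup>2) (s\<^sup>2)"
proof -
  \<comment> \<open>For t = 1 or t = -1 the combination has variance 2 s, and its fourth moment is
    \<open>3 (2 s)^2 = 12 s^2\<close>.\<close>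
  have *: "has_bochner_integral M (\<lambda>\<omega>. (e i \<omega> + t * e j \<omega>) ^ 4) (12 * s\<^sup>2)" if "t\<^sup>2 = 1" for t :: real
  proof -
    let ?c = "\<lambda>l. if l = i then 1 else if l = j then t else 0"
    have 1: "(\<Sum>l<m. ?c l * e l \<omega>) = e i \<omega> + t * e j \<omega>" for \<omega>
    proof -
      have "(\<Sum>l<m. ?c l * e l \<omega>) = (\<Sum>l<m. (if l = i then e l \<omega> else 0) + (if l = j then t * e l \<omega> else 0))"
        using assms by (intro sum.cong) auto
      then show ?thesis using assms by (simp add: sum.distrib)
    qed
    have 2: "(\<Sum>l<m. (?c l)\<^sup>2) = 2"
    proof -
      have "(\<Sum>l<m. (?c l)\<^sup>2) = (\<Sum>l<m. (if l = i then 1 else 0) + (if l = j then 1 else 0))"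
        using assms that by (intro sum.cong) auto
      then show ?thesis using assms by (simp add: sum.distrib)
    qed
    show ?thesis using lin4[of ?c] unfolding 1 2 by simp
  qed
  have "has_bochner_integral M (\<lambda>\<omega>. (1/12) * ((e i \<omega> + 1 * e j \<omega>) ^ 4 + (e i \<omega> + (-1) * e j \<omega>) ^ 4
      - 2 * e i \<omega> ^ 4 - 2 * e j \<omega> ^ 4))
    ((1/12) * (12 * s\<^sup>2 + 12 * s\<^sup>2 - 2 * (3 * s\<^sup>2) - 2 * (3 * s\<^sup>2)))"
    by (intro has_bochner_integral_mult_right has_bochner_integral_diff has_bochner_integral_add *
        component_moments assms) simp_all
  moreover have "(1/12) * ((e i \<omega> + 1 * e j \<omega>) ^ 4 + (e i \<omega> + (-1) * e j \<omega>) ^ 4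
      - 2 * e i \<omega> ^ 4 - 2 * e j \<omega> ^ 4) = (e i \<omega>)\<^sup>2 * (e j \<omega>)\<^sup>2" for \<omega>
    by (simp add: power2_eq_square power4_eq_xxxx algebra_simps)
  ultimately show ?thesis by simp
qed

text \<open>The square is expanded into a double sum. Off the diagonal the covariances vanish by
  \<open>product_moment\<close>; each diagonal term contributes \<open>3 s^2 - s^2\<close>.\<close>

lemma quadratic_variance:
  assumes "k \<le> m"
  shows "has_bochner_integral M (\<lambda>\<omega>. (\<Sum>i<k. (e i \<omega>)\<^sup>2 - s)\<^sup>2) (2 * s\<^sup>2 * real k)"
proof -
  have 1: "has_bochner_integral M (\<lambda>\<omega>. ((e i \<omega>)\<^sup>2 - s) * ((e j \<omega>)\<^sup>2 - s)) (if i = j then 2 * s\<^sup>2 else 0)"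
    if "i < m" "j < m" for i j
  proof -
    have p: "has_bochner_integral M (\<lambda>\<omega>. (e i \<omega>)\<^sup>2 * (e j \<omega>)\<^sup>2) (if i = j then 3 * s\<^sup>2 else s\<^sup>2)"
      using product_moment[OF that] component_moments(3)[OF that(1)]
      by (auto simp: power2_eq_square power4_eq_xxxx algebra_simps)
    have const: "has_bochner_integral M (\<lambda>\<omega>. s * s) (s * s)"
      by (simp add: has_bochner_integral_iff prob_space)
    have "has_bochner_integral M (\<lambda>\<omega>. (e i \<omega>)\<^sup>2 * (e j \<omega>)\<^sup>2 - s * (e i \<omega>)\<^sup>2 - s * (e j \<omega>)\<^sup>2 + s * s)
      ((if i = j then 3 * s\<^sup>2 else s\<^sup>2) - s * s - s * s + s * s)"
      by (intro has_bochner_integral_add has_bochner_integral_diff has_bochner_integral_mult_right p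
          component_moments that const)
    then show ?thesis by (auto simp: power2_eq_square algebra_simps split: if_splits)
  qed
  have "has_bochner_integral M (\<lambda>\<omega>. \<Sum>i<k. \<Sum>j<k. ((e i \<omega>)\<^sup>2 - s) * ((e j \<omega>)\<^sup>2 - s))
     (\<Sum>i<k. \<Sum>j<k. if i = j then 2 * s\<^sup>2 else 0)"
    using assms by (intro has_bochner_integral_sum 1) auto
  then show ?thesis by (simp add: power2_eq_square sum_product mult.commute)
qed

lemma linear_variance:
  assumes "k \<le> m"
  shows "has_bochner_integral M (\<lambda>\<omega>. (\<Sum>i<k. c i * e i \<omega>)\<^sup>2) (s * (\<Sum>i<k. (c i)\<^sup>2))"
proof -
  let ?c = "\<lambda>i. if i < k then c i else 0"
  have 1: "(\<Sum>i<m. ?c i * e i \<omega>) = (\<Sum>i<k. c i * e i \<omega>)" for \<omega>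
    using assms by (intro sum.mono_neutral_cong_right) auto
  have 2: "(\<Sum>i<m. (?c i)\<^sup>2) = (\<Sum>i<k. (c i)\<^sup>2)"
    using assms by (intro sum.mono_neutral_cong_right) auto
  show ?thesis using lin2[of ?c] unfolding 1 2 .
qed

text \<open>The deviation is \<open>Q + 2 L\<close>, with Q the centred quadratic part and L the
  part linear in the noise. Then \<open>(Q + 2 L)^2 \<le> 2 Q^2 + 8 L^2\<close> avoids computing the
  mixed moment of Q and L, and produces the constants 4 and 8 of the Chebyshev bound.\<close>

lemma data_square_partial_sum_deviation:
  assumes "k \<le> m" "0 < t" "0 \<le> s" "\<And>i. i < m \<Longrightarrow> \<bar>c i\<bar> \<le> b"
  shows "prob {\<omega>\<in>space M. t \<le> \<bar>\<Sum>i<k. (c i + e i \<omega>)\<^sup>2 - ((c i)\<^sup>2 + s)\<bar>}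
    \<le> (4 * s\<^sup>2 + 8 * s * b\<^sup>2) * real k / t\<^sup>2"
proof -
  let ?D = "\<lambda>\<omega>. \<Sum>i<k. (c i + e i \<omega>)\<^sup>2 - ((c i)\<^sup>2 + s)"
  let ?Q = "\<lambda>\<omega>. \<Sum>i<k. (e i \<omega>)\<^sup>2 - s" and ?L = "\<lambda>\<omega>. \<Sum>i<k. c i * e i \<omega>"
  have D: "?D \<omega> = ?Q \<omega> + 2 * ?L \<omega>" for \<omega>
    by (simp add: sum_distrib_left sum.distrib[symmetric] power2_eq_square algebra_simps)
  have meas: "?D \<in> borel_measurable M"
    using assms(1) by (intro borel_measurable_sum borel_measurable_diff borel_measurable_power
      borel_measurable_add component_measurable) auto
  have bnd: "(?D \<omega>)\<^sup>2 \<le> 2 * (?Q \<omega>)\<^sup>2 + 8 * (?L \<omega>)\<^sup>2" for \<omega>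
  proof -
    have "0 \<le> (?Q \<omega> - 2 * ?L \<omega>)\<^sup>2" by simp
    then show ?thesis unfolding D by (simp add: power2_eq_square algebra_simps)
  qed
  have H: "has_bochner_integral M (\<lambda>\<omega>. 2 * (?Q \<omega>)\<^sup>2 + 8 * (?L \<omega>)\<^sup>2)
      (2 * (2 * s\<^sup>2 * real k) + 8 * (s * (\<Sum>i<k. (c i)\<^sup>2)))"
    by (intro has_bochner_integral_add has_bochner_integral_mult_right quadratic_variance linear_variance assms)
  have int: "integrable M (\<lambda>\<omega>. (?D \<omega>)\<^sup>2)"
    by (rule Bochner_Integration.integrable_bound[of M "\<lambda>\<omega>. 2 * (?Q \<omega>)\<^sup>2 + 8 * (?L \<omega>)\<^sup>2"])
       (use H meas bnd in \<open>auto simp: has_bochner_integral_iff intro!: AE_I2 order.trans[OF bnd] \<close>)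
  have "(\<Sum>i<k. (c i)\<^sup>2) \<le> (\<Sum>i<k. b\<^sup>2)"
    using assms(1,4) by (intro sum_mono) (metis abs_le_square_iff abs_of_nonneg abs_ge_zero order.trans lessThan_iff order_less_le_trans)
  then have cb: "s * (\<Sum>i<k. (c i)\<^sup>2) \<le> s * (real k * b\<^sup>2)"
    using assms(3) by (intro mult_left_mono) auto
  have "expectation (\<lambda>\<omega>. (?D \<omega>)\<^sup>2) \<le> expectation (\<lambda>\<omega>. 2 * (?Q \<omega>)\<^sup>2 + 8 * (?L \<omega>)\<^sup>2)"
    using int H bnd by (intro integral_mono) (auto simp: has_bochner_integral_iff)
  also have "\<dots> \<le> (4 * s\<^sup>2 + 8 * s * b\<^sup>2) * real k"
    using H cb by (simp add: has_bochner_integral_iff algebra_simps)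
  finally have E: "expectation (\<lambda>\<omega>. (?D \<omega>)\<^sup>2) \<le> (4 * s\<^sup>2 + 8 * s * b\<^sup>2) * real k" .
  have "prob {\<omega>\<in>space M. t \<le> \<bar>?D \<omega>\<bar>} \<le> expectation (\<lambda>\<omega>. (?D \<omega>)\<^sup>2) / t\<^sup>2"
    by (rule second_moment_method[OF meas int assms(2)])
  also have "\<dots> \<le> (4 * s\<^sup>2 + 8 * s * b\<^sup>2) * real k / t\<^sup>2"
    using E by (intro divide_right_mono) auto
  finally show ?thesis .
qed

end

text \<open>A linear combination of the rotated coordinates is a linear combination of the original
  independent ones, with the coefficient vector multiplied by \<open>P\<close>. Its law is normal
  with a variance that depends only on the norm of that vector, and \<open>P\<close> preserves the
  norm.\<close>

lemma gaussian_noise_isotropic: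
  assumes "prob_space M" "0 < \<sigma>" and noise: "gaussian_noise M m \<sigma> \<epsilon>" and P: "orthonormal_mat m P"
  shows "isotropic_noise M m (\<sigma>\<^sup>2) (\<lambda>i \<omega>. col P i \<bullet> \<epsilon> \<omega>)"
proof -
  interpret prob_space M by fact
  have ind: "indep_vars (\<lambda>_. borel) (\<lambda>i \<omega>. \<epsilon> \<omega> $ i) {..<m}"
    and dist: "\<And>i. i < m \<Longrightarrow> distributed M lborel (\<lambda>\<omega>. \<epsilon> \<omega> $ i) (normal_density 0 \<sigma>)"
    and car: "\<And>\<omega>. \<omega> \<in> space M \<Longrightarrow> \<epsilon> \<omega> \<in> carrier_vec m"
    using noise by (auto simp: gaussian_noise_def)
  have mom: "has_bochner_integral M (\<lambda>\<omega>. \<Sum>a<m. d a * (\<epsilon> \<omega> $ a)) 0"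
    "has_bochner_integral M (\<lambda>\<omega>. (\<Sum>a<m. d a * (\<epsilon> \<omega> $ a))\<^sup>2) (\<sigma>\<^sup>2 * (\<Sum>a<m. (d a)\<^sup>2))"
    "has_bochner_integral M (\<lambda>\<omega>. (\<Sum>a<m. d a * (\<epsilon> \<omega> $ a)) ^ 4) (3 * (\<sigma>\<^sup>2)\<^sup>2 * (\<Sum>a<m. (d a)\<^sup>2)\<^sup>2)"
    for d :: "nat \<Rightarrow> real"
  proof -
    let ?q = "\<Sum>a<m. (d a)\<^sup>2" and ?Z = "\<lambda>\<omega>. \<Sum>a<m. d a * (\<epsilon> \<omega> $ a)"
    have "has_bochner_integral M ?Z 0 \<and> has_bochner_integral M (\<lambda>\<omega>. (?Z \<omega>)\<^sup>2) (\<sigma>\<^sup>2 * ?q)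
      \<and> has_bochner_integral M (\<lambda>\<omega>. (?Z \<omega>) ^ 4) (3 * (\<sigma>\<^sup>2)\<^sup>2 * ?q\<^sup>2)"
    \<comment> \<open>With all coefficients 0 the combination is the constant 0, which has no normal
      density; its moments are checked separately.\<close>
    proof (cases "?q = 0")
      case True
      then have "\<forall>a<m. d a = 0" by (auto simp: sum_nonneg_eq_0_iff)
      then have "?Z \<omega> = 0" for \<omega> by (intro sum.neutral) auto
      then show ?thesis using True by (simp add: has_bochner_integral_zero)
    next
      case False
      then have q: "0 < ?q" using sum_nonneg[of "{..<m}" "\<lambda>a. (d a)\<^sup>2"] by fastforce
      note n = normal_linear_combination[OF assms(2) ind dist q]
      have "0 < \<sigma> * sqrt ?q" using q assms(2) by simp
      note z = centered_normal_moments[OF this n]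
      have t2: "(\<sigma> * sqrt ?q)\<^sup>2 = \<sigma>\<^sup>2 * ?q" using q by (simp add: power_mult_distrib)
      have "(\<sigma> * sqrt ?q) ^ 4 = ((\<sigma> * sqrt ?q)\<^sup>2)\<^sup>2" by simp
      then have t4: "3 * (\<sigma> * sqrt ?q) ^ 4 = 3 * (\<sigma>\<^sup>2)\<^sup>2 * ?q\<^sup>2"
        unfolding t2 by (simp add: power_mult_distrib)
      show ?thesis using z unfolding t2 t4 by blast
    qed
    then show "has_bochner_integral M ?Z 0" "has_bochner_integral M (\<lambda>\<omega>. (?Z \<omega>)\<^sup>2) (\<sigma>\<^sup>2 * ?q)"
      "has_bochner_integral M (\<lambda>\<omega>. (?Z \<omega>) ^ 4) (3 * (\<sigma>\<^sup>2)\<^sup>2 * ?q\<^sup>2)" by auto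
  qed
  \<comment> \<open>\<open>d c\<close> is the vector \<open>P c\<close>; \<open>dq\<close> below
    states that \<open>P\<close> preserves its norm.\<close>
  define d where "d c a = (\<Sum>i<m. c i * P $$ (a, i))" for c :: "nat \<Rightarrow> real" and a
  have Pc: "P \<in> carrier_mat m m" using P by (rule orthonormal_mat_carrier)
  have dq: "(\<Sum>a<m. (d c a)\<^sup>2) = (\<Sum>i<m. (c i)\<^sup>2)" for c
  proof -
    have "(\<Sum>a<m. (d c a)\<^sup>2) = (\<Sum>a<m. \<Sum>i<m. \<Sum>j<m. c i * c j * (P $$ (a, i) * P $$ (a, j)))"
      unfolding d_def power2_eq_square sum_product by (simp add: algebra_simps)
    also have "\<dots> = (\<Sum>i<m. \<Sum>a<m. \<Sum>j<m. c i * c j * (P $$ (a, i) * P $$ (a, j)))"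
      by (rule sum.swap)
    also have "\<dots> = (\<Sum>i<m. \<Sum>j<m. \<Sum>a<m. c i * c j * (P $$ (a, i) * P $$ (a, j)))"
      by (intro sum.cong refl sum.swap)
    also have "\<dots> = (\<Sum>i<m. \<Sum>j<m. c i * c j * (\<Sum>a<m. P $$ (a, i) * P $$ (a, j)))"
      by (simp add: sum_distrib_left)
    also have "\<dots> = (\<Sum>i<m. \<Sum>j<m. if i = j then c i * c j else 0)"
      by (intro sum.cong refl) (simp add: orthonormal_mat_col_inner[OF P])
    also have "\<dots> = (\<Sum>i<m. (c i)\<^sup>2)" by (simp add: power2_eq_square)
    finally show ?thesis .
  qed
  have comb: "(\<Sum>i<m. c i * (col P i \<bullet> \<epsilon> \<omega>)) = (\<Sum>a<m. d c a * (\<epsilon> \<omega> $ a))" if "\<omega> \<in> space M" for c \<omega>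
  proof -
    have "(\<Sum>i<m. c i * (col P i \<bullet> \<epsilon> \<omega>)) = (\<Sum>i<m. \<Sum>a<m. c i * P $$ (a, i) * (\<epsilon> \<omega> $ a))"
      using Pc car[OF that]
      by (intro sum.cong refl) (auto simp: scalar_prod_def sum_distrib_left lessThan_atLeast0 mult.assoc intro!: sum.cong)
    also have "\<dots> = (\<Sum>a<m. d c a * (\<epsilon> \<omega> $ a))"
      unfolding d_def sum_distrib_right by (rule sum.swap)
    finally show ?thesis .
  qed
  show ?thesis
  proof
    fix c :: "nat \<Rightarrow> real"
    show "has_bochner_integral M (\<lambda>\<omega>. \<Sum>i<m. c i * (col P i \<bullet> \<epsilon> \<omega>)) 0"
      using mom(1)[of "d c"] by (subst has_bochner_integral_cong[OF refl comb refl])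
    show "has_bochner_integral M (\<lambda>\<omega>. (\<Sum>i<m. c i * (col P i \<bullet> \<epsilon> \<omega>))\<^sup>2) (\<sigma>\<^sup>2 * (\<Sum>i<m. (c i)\<^sup>2))"
      using mom(2)[of "d c"] unfolding dq
      by (subst has_bochner_integral_cong[OF refl _ refl, where g="\<lambda>\<omega>. (\<Sum>a<m. d c a * (\<epsilon> \<omega> $ a))\<^sup>2"])
         (simp_all add: comb)
    show "has_bochner_integral M (\<lambda>\<omega>. (\<Sum>i<m. c i * (col P i \<bullet> \<epsilon> \<omega>)) ^ 4) (3 * (\<sigma>\<^sup>2)\<^sup>2 * (\<Sum>i<m. (c i)\<^sup>2)\<^sup>2)"
      using mom(3)[of "d c"] unfolding dq
      by (subst has_bochner_integral_cong[OF refl _ refl, where g="\<lambda>\<omega>. (\<Sum>a<m. d c a * (\<epsilon> \<omega> $ a)) ^ 4"])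
         (simp_all add: comb)
  qed
qed

section \<open>Uniform control of monotonically weighted sums\<close>

lemma weighted_sum_le_partial_sums:
  fixes w d :: "nat \<Rightarrow> real"
  assumes mono: "\<And>i j. i \<le> j \<Longrightarrow> j < m \<Longrightarrow> w i \<le> w j"
    and bounds: "\<And>i. i < m \<Longrightarrow> 0 \<le> w i" "\<And>i. i < m \<Longrightarrow> w i \<le> 1"
    and S: "\<And>k. k \<le> m \<Longrightarrow> \<bar>\<Sum>i<k. d i\<bar> \<le> t"
  shows "\<bar>\<Sum>i<m. w i * d i\<bar> \<le> 2 * t"
proof -
  \<comment> \<open>The weight is continued by 1 past the last index, so that the induction can end
    at \<open>v m = 1\<close>.\<close>
  define v where "v i = (if i < m then w i else 1)" for i
  have v: "0 \<le> v i" "v i \<le> 1" "v i \<le> v (Suc i)" for i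
    using assms by (auto simp: v_def)
  have t: "0 \<le> t" using S[of 0] by simp
  \<comment> \<open>Summation by parts: the remainder collects partial sums multiplied by increments
    of the weight. As the weight is nondecreasing and starts nonnegative, these increments add up to
    at most \<open>v k\<close>. At \<open>k = m\<close> the remainder costs t and the full sum
    another t, whence the factor 2.\<close>
  have "\<bar>(\<Sum>i<k. v i * d i) - v k * (\<Sum>i<k. d i)\<bar> \<le> t * v k" if "k \<le> m" for k
    using that
  proof (induction k)
    case 0
    then show ?case using t v(1)[of 0] by simp
  next
    case (Suc k)
    let ?S = "\<Sum>i<Suc k. d i"
    have eq: "(\<Sum>i<Suc k. v i * d i) - v (Suc k) * ?S
        = ((\<Sum>i<k. v i * d i) - v k * (\<Sum>i<k. d i)) - (v (Suc k) - v k) * ?S"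
      by (simp add: algebra_simps)
    have "\<bar>(v (Suc k) - v k) * ?S\<bar> \<le> (v (Suc k) - v k) * t"
      using v(3)[of k] S[OF Suc.prems] by (simp add: abs_mult mult_left_mono)
    moreover have "\<bar>(\<Sum>i<k. v i * d i) - v k * (\<Sum>i<k. d i)\<bar> \<le> t * v k" using Suc by simp
    ultimately show ?case unfolding eq by (simp add: algebra_simps)
  qed
  from this[of m] have "\<bar>(\<Sum>i<m. v i * d i) - (\<Sum>i<m. d i)\<bar> \<le> t"
    by (simp add: v_def)
  moreover have "(\<Sum>i<m. v i * d i) = (\<Sum>i<m. w i * d i)" by (intro sum.cong) (auto simp: v_def)
  ultimately show ?thesis using S[of m] by simp
qed

text \<open>Monotone partial sums are controlled by their values on a grid, as in the proof of the
  Glivenko--Cantelli theorem.\<close>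

lemma partial_sums_le_grid:
  fixes z \<mu> :: "nat \<Rightarrow> real"
  assumes z: "\<And>i. i < m \<Longrightarrow> 0 \<le> z i" and \<mu>: "\<And>i. i < m \<Longrightarrow> 0 \<le> \<mu> i" "\<And>i. i < m \<Longrightarrow> \<mu> i \<le> K"
    and "0 \<le> K" "m \<le> N * L" "k \<le> m"
    and grid: "\<And>j. j \<le> N \<Longrightarrow> \<bar>\<Sum>i<min (j * L) m. z i - \<mu> i\<bar> \<le> t"
  shows "\<bar>\<Sum>i<k. z i - \<mu> i\<bar> \<le> t + K * real L"
proof (cases "k = m")
  case True
  \<comment> \<open>The endpoint is itself a grid point. It is treated apart because for
    \<open>k < m\<close> the index \<open>j = k div L\<close> is below N, so that its right
    neighbour \<open>Suc j\<close> still belongs to the grid.\<close>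
  have "min (N * L) m = m" using assms(5) by simp
  moreover have "0 \<le> K * real L" using assms(4) by simp
  ultimately show ?thesis using grid[of N] True by simp
next
  case False
  then have km: "k < m" using assms(6) by simp
  then have L: "0 < L" using assms(5) by (cases L) auto
  define j where "j = k div L"
  define a b where "a = min (j * L) m" and "b = min (Suc j * L) m"
  have "j < N" unfolding j_def using km assms(5) by (intro less_mult_imp_div_less) simp
  have ak: "a \<le> k" "k \<le> b" "b \<le> m" "b \<le> k + L" "k \<le> a + L"
  proof -
    define n where "n = j * L"
    have "n \<le> k" "k < n + L"
      using dividend_less_div_times[OF L, of k] by (simp_all add: add.commute n_def j_def)
    moreover have "a = min n m" "b = min (n + L) m" by (simp_all add: a_def b_def n_def)
    ultimately show "a \<le> k" "k \<le> b" "b \<le> m" "b \<le> k + L" "k \<le> a + L"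
      using km by auto
  qed
  have diff: "0 \<le> sum \<mu> {p..<q}" "sum \<mu> {p..<q} \<le> K * real L" "0 \<le> sum z {p..<q}"
    if "p \<le> q" "q \<le> m" "q \<le> p + L" for p q
  proof -
    show "0 \<le> sum \<mu> {p..<q}" "0 \<le> sum z {p..<q}" using that z \<mu> by (auto intro!: sum_nonneg)
    have "sum \<mu> {p..<q} \<le> K * real (q - p)"
      using sum_bounded_above[of "{p..<q}" \<mu> K] that \<mu>(2) by (simp add: mult.commute)
    also have "\<dots> \<le> K * real L" using that assms(4) by (intro mult_left_mono) auto
    finally show "sum \<mu> {p..<q} \<le> K * real L" .
  qed
  have split: "sum h {..<q} = sum h {..<p} + sum h {p..<q}" if "p \<le> q" for p q and h :: "nat \<Rightarrow> real"
    using that by (simp add: lessThan_atLeast0 sum.atLeastLessThan_concat)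
  \<comment> \<open>The lower grid point \<open>a\<close> bounds the sum of z up to k from below and
    the upper one \<open>b\<close> bounds it from above. The sum of \<mu> changes by at most
    \<open>K * L\<close> between k and either of them.\<close>
  have "\<bar>sum z {..<a} - sum \<mu> {..<a}\<bar> \<le> t" "\<bar>sum z {..<b} - sum \<mu> {..<b}\<bar> \<le> t"
    using grid[of j] grid[of "Suc j"] \<open>j < N\<close> by (auto simp: a_def b_def sum_subtractf)
  then show ?thesis
    using diff[of a k] diff[of k b] split[OF ak(1), of z] split[OF ak(1), of \<mu>]
      split[OF ak(2), of z] split[OF ak(2), of \<mu>] ak km
    by (simp add: sum_subtractf)
qed

section \<open>The spectral form of the risk\<close>

definition spectral_risk :: "nat \<Rightarrow> real \<Rightarrow> (nat \<Rightarrow> real) \<Rightarrow> (nat \<Rightarrow> real) \<Rightarrow> real \<Rightarrow> real" where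
  "spectral_risk m s g x \<alpha> =
     (\<Sum>i<m. ((1 - shrinkage (g i) \<alpha>) * (g i * x i))\<^sup>2 + (shrinkage (g i) \<alpha>)\<^sup>2 * s)"

lemma shrinkage_bounds:
  assumes "0 < \<alpha>" shows "0 \<le> shrinkage g \<alpha>" "shrinkage g \<alpha> \<le> 1"
proof -
  have "0 < g\<^sup>2 + \<alpha>" using assms by (simp add: add_nonneg_pos)
  then show "0 \<le> shrinkage g \<alpha>" "shrinkage g \<alpha> \<le> 1" using assms by (simp_all add: shrinkage_def)
qed

lemma shrinkage_mono:
  assumes "0 < \<alpha>" "0 \<le> g" "g \<le> h" shows "shrinkage g \<alpha> \<le> shrinkage h \<alpha>"
proof -
  have p: "0 < g\<^sup>2 + \<alpha>" "0 < h\<^sup>2 + \<alpha>" using assms by (simp_all add: add_nonneg_pos)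
  have "g\<^sup>2 \<le> h\<^sup>2" using assms by (intro power_mono)
  then show ?thesis using p assms(1) by (simp add: shrinkage_def divide_simps algebra_simps)
qed

lemma spectral_risk_deriv:
  assumes "0 < z"
  shows "(spectral_risk m s g x has_real_derivative
    (\<Sum>i<m. 2 * (g i) ^ 4 * (z * (x i)\<^sup>2 - s) / ((g i)\<^sup>2 + z) ^ 3)) (at z)"
  unfolding spectral_risk_def
proof (rule DERIV_sum)
  fix i
  have p: "(g i)\<^sup>2 + z \<noteq> 0" using assms by (smt (verit) zero_le_power2)
  have D: "(shrinkage (g i) has_real_derivative - (g i)\<^sup>2 / ((g i)\<^sup>2 + z)\<^sup>2) (at z)"
    unfolding shrinkage_def using p by (auto intro!: derivative_eq_intros simp: power2_eq_square)
  have c: "1 - shrinkage (g i) z = z / ((g i)\<^sup>2 + z)" using p by (simp add: shrinkage_def field_simps)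
  show "((\<lambda>\<alpha>. ((1 - shrinkage (g i) \<alpha>) * (g i * x i))\<^sup>2 + (shrinkage (g i) \<alpha>)\<^sup>2 * s) has_real_derivative
      2 * (g i) ^ 4 * (z * (x i)\<^sup>2 - s) / ((g i)\<^sup>2 + z) ^ 3) (at z)"
    using p
    by (auto intro!: derivative_eq_intros D simp: c)
       (simp add: shrinkage_def divide_simps power2_eq_square power3_eq_cube power4_eq_xxxx,
        simp add: algebra_simps)
qed

lemma spectral_risk_mvt:
  assumes "0 < a" "a < b'"
  obtains z where "a < z" "z < b'" "spectral_risk m s g x b' - spectral_risk m s g x a
    = (b' - a) * (\<Sum>i<m. 2 * (g i) ^ 4 * (z * (x i)\<^sup>2 - s) / ((g i)\<^sup>2 + z) ^ 3)"
proof -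
  have "\<exists>z>a. z < b' \<and> spectral_risk m s g x b' - spectral_risk m s g x a
    = (b' - a) * (\<Sum>i<m. 2 * (g i) ^ 4 * (z * (x i)\<^sup>2 - s) / ((g i)\<^sup>2 + z) ^ 3)"
    using assms by (intro MVT2 spectral_risk_deriv) auto
  then show ?thesis using that by auto
qed

text \<open>Every estimate below depends on the dimension and on the spectral data only through the
  explicit factor m and the constants of its hypotheses. The same \<open>s\<close> and
  \<open>b\<close> serve for all m, so the conclusions are uniform after division by m.\<close>

locale spectral_bounds =
  fixes m :: nat and s b :: real and g x :: "nat \<Rightarrow> real"
  assumes s: "0 < s" and b: "0 < b"
    and g: "\<And>i. i < m \<Longrightarrow> 0 \<le> g i" "\<And>i. i < m \<Longrightarrow> g i \<le> 1"
    and x: "\<And>i. i < m \<Longrightarrow> \<bar>x i\<bar> \<le> b"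
begin

lemma x_square_le: "i < m \<Longrightarrow> (x i)\<^sup>2 \<le> b\<^sup>2"
  using x[of i] b by (simp add: abs_le_square_iff[symmetric])

lemma g_power_le: "i < m \<Longrightarrow> (g i) ^ n \<le> 1"
  using g[of i] by (simp add: power_le_one)

lemma risk_bounds:
  assumes "0 < \<alpha>"
  shows "0 \<le> spectral_risk m s g x \<alpha>" "spectral_risk m s g x \<alpha> \<le> real m * (b\<^sup>2 + s)"
proof -
  show "0 \<le> spectral_risk m s g x \<alpha>" unfolding spectral_risk_def using s by (intro sum_nonneg) auto
  have "((1 - shrinkage (g i) \<alpha>) * (g i * x i))\<^sup>2 + (shrinkage (g i) \<alpha>)\<^sup>2 * s \<le> b\<^sup>2 + s" if "i < m" for i
  proof -
    have u: "0 \<le> shrinkage (g i) \<alpha>" "shrinkage (g i) \<alpha> \<le> 1" using shrinkage_bounds[OF assms] by auto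
    have "(1 - shrinkage (g i) \<alpha>)\<^sup>2 * ((g i)\<^sup>2 * (x i)\<^sup>2) \<le> 1 * (1 * b\<^sup>2)"
      using u x_square_le[OF that] g_power_le[OF that, of 2]
      by (intro mult_mono) (auto simp: power_le_one)
    moreover have "(shrinkage (g i) \<alpha>)\<^sup>2 * s \<le> 1 * s"
      using u s by (intro mult_right_mono) (auto simp: power_le_one)
    ultimately show ?thesis by (simp add: power_mult_distrib)
  qed
  then have "spectral_risk m s g x \<alpha> \<le> (\<Sum>i<m. b\<^sup>2 + s)"
    unfolding spectral_risk_def by (intro sum_mono) auto
  then show "spectral_risk m s g x \<alpha> \<le> real m * (b\<^sup>2 + s)" by simp
qed

text \<open>In each summand of the derivative the numerator is at most \<open>2 (z b^2 + s)\<close>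
  and the denominator at least \<open>z^3\<close>. Together with \<open>risk_bounds\<close> this
  gives, per dimension, the equicontinuity and boundedness required by the Arzela-Ascoli theorem;
  the constant deteriorates only as the left end a tends to 0.\<close>

lemma risk_lipschitz:
  assumes "0 < a" "a \<le> \<alpha>" "a \<le> \<beta>"
  shows "\<bar>spectral_risk m s g x \<alpha> - spectral_risk m s g x \<beta>\<bar>
    \<le> real m * (2 * b\<^sup>2 / a\<^sup>2 + 2 * s / a ^ 3) * \<bar>\<alpha> - \<beta>\<bar>"
proof -
  let ?K = "2 * b\<^sup>2 / a\<^sup>2 + 2 * s / a ^ 3"
  have D: "\<bar>\<Sum>i<m. 2 * (g i) ^ 4 * (z * (x i)\<^sup>2 - s) / ((g i)\<^sup>2 + z) ^ 3\<bar> \<le> real m * ?K" if "a \<le> z" for z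
  proof -
    have z: "0 < z" using that assms(1) by simp
    have "\<bar>2 * (g i) ^ 4 * (z * (x i)\<^sup>2 - s) / ((g i)\<^sup>2 + z) ^ 3\<bar> \<le> ?K" if i: "i < m" for i
    proof -
      have p: "z ^ 3 \<le> ((g i)\<^sup>2 + z) ^ 3" using z by (intro power_mono) auto
      have q: "0 < z ^ 3" using z by simp
      have "\<bar>z * (x i)\<^sup>2 - s\<bar> \<le> z * b\<^sup>2 + s"
      proof -
        have "z * (x i)\<^sup>2 \<le> z * b\<^sup>2" "0 \<le> z * (x i)\<^sup>2"
          using x_square_le[OF i] z by (auto intro: mult_left_mono)
        then show ?thesis using s by linarith
      qed
      then have "2 * (g i) ^ 4 * \<bar>z * (x i)\<^sup>2 - s\<bar> \<le> 2 * 1 * (z * b\<^sup>2 + s)"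
        using g_power_le[OF i] g[OF i] by (intro mult_mono) auto
      then have "\<bar>2 * (g i) ^ 4 * (z * (x i)\<^sup>2 - s) / ((g i)\<^sup>2 + z) ^ 3\<bar> \<le> 2 * (z * b\<^sup>2 + s) / z ^ 3"
        using p q g[OF i] z s by (auto simp: abs_mult intro!: frac_le)
      also have "\<dots> = 2 * b\<^sup>2 / z\<^sup>2 + 2 * s / z ^ 3"
        using z by (simp add: field_simps power2_eq_square power3_eq_cube)
      also have "\<dots> \<le> ?K"
        using assms(1) that \<open>a \<le> z\<close> s by (intro add_mono divide_left_mono power_mono mult_pos_pos) auto
      finally show ?thesis .
    qed
    then have "(\<Sum>i<m. \<bar>2 * (g i) ^ 4 * (z * (x i)\<^sup>2 - s) / ((g i)\<^sup>2 + z) ^ 3\<bar>) \<le> (\<Sum>i<m. ?K)"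
      by (intro sum_mono) auto
    then have "(\<Sum>i<m. \<bar>2 * (g i) ^ 4 * (z * (x i)\<^sup>2 - s) / ((g i)\<^sup>2 + z) ^ 3\<bar>) \<le> real m * ?K" by simp
    then show ?thesis by (rule order_trans[OF sum_abs])
  qed
  have "\<bar>spectral_risk m s g x \<alpha> - spectral_risk m s g x \<beta>\<bar> \<le> real m * ?K * \<bar>\<alpha> - \<beta>\<bar>"
    if "a \<le> \<alpha>" "\<alpha> < \<beta>" for \<alpha> \<beta>
  proof -
    obtain z where z: "\<alpha> < z" "z < \<beta>" "spectral_risk m s g x \<beta> - spectral_risk m s g x \<alpha>
      = (\<beta> - \<alpha>) * (\<Sum>i<m. 2 * (g i) ^ 4 * (z * (x i)\<^sup>2 - s) / ((g i)\<^sup>2 + z) ^ 3)"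
      using assms(1) \<open>a \<le> \<alpha>\<close> \<open>\<alpha> < \<beta>\<close> by (rule_tac spectral_risk_mvt[of \<alpha> \<beta> m s g x]) auto
    have "\<bar>(\<beta> - \<alpha>) * (\<Sum>i<m. 2 * (g i) ^ 4 * (z * (x i)\<^sup>2 - s) / ((g i)\<^sup>2 + z) ^ 3)\<bar> \<le> \<bar>\<beta> - \<alpha>\<bar> * (real m * ?K)"
      unfolding abs_mult using D[of z] z that by (intro mult_left_mono) auto
    then show ?thesis unfolding z(3)[symmetric] by (simp add: abs_minus_commute mult.commute)
  qed
  from this[of \<alpha> \<beta>] this[of \<beta> \<alpha>] assms show ?thesis
    by (cases \<alpha> \<beta> rule: linorder_cases) (auto simp: abs_minus_commute)
qed

text \<open>For z below \<rho> one has \<open>z x^2 \<le> s / 2\<close>, and the denominator is at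
  most \<open>2^3\<close>, so every summand of the derivative is at most \<open>- g^4 s / 8\<close>.
  Since \<open>x^2 \<le> b^2\<close>, the sum of \<open>g^4\<close> is at least
  \<open>c m / b^2\<close>. Integrating over an interval of length at least \<rho>/2 gives the
  constant 16.\<close>

lemma risk_near_zero:
  assumes c: "0 < c" "c * real m \<le> (\<Sum>i<m. (g i) ^ 4 * (x i)\<^sup>2)"
    and \<rho>: "0 < \<rho>" "\<rho> \<le> 1" "2 * \<rho> * b\<^sup>2 \<le> s" and \<alpha>: "0 < \<alpha>" "\<alpha> \<le> \<rho> / 2"
  shows "spectral_risk m s g x \<rho> + real m * (\<rho> * s * c / (16 * b\<^sup>2)) \<le> spectral_risk m s g x \<alpha>"
proof -
  obtain z where z: "\<alpha> < z" "z < \<rho>" "spectral_risk m s g x \<rho> - spectral_risk m s g x \<alpha>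
      = (\<rho> - \<alpha>) * (\<Sum>i<m. 2 * (g i) ^ 4 * (z * (x i)\<^sup>2 - s) / ((g i)\<^sup>2 + z) ^ 3)"
    using \<alpha> \<rho> by (rule_tac spectral_risk_mvt[of \<alpha> \<rho> m s g x]) auto
  have z0: "0 < z" using z \<alpha> by simp
  have "2 * (g i) ^ 4 * (z * (x i)\<^sup>2 - s) / ((g i)\<^sup>2 + z) ^ 3 \<le> - (s / (8 * b\<^sup>2)) * ((g i) ^ 4 * (x i)\<^sup>2)"
    if i: "i < m" for i
  proof -
    have "z * (x i)\<^sup>2 \<le> \<rho> * b\<^sup>2" using z z0 x_square_le[OF i] \<rho> by (intro mult_mono) auto
    then have n: "z * (x i)\<^sup>2 - s \<le> - (s / 2)" using \<rho> by simp
    have p: "((g i)\<^sup>2 + z) ^ 3 \<le> 2 ^ 3"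
      using g_power_le[OF i, of 2] z z0 \<rho> by (intro power_mono) auto
    have q: "0 < ((g i)\<^sup>2 + z) ^ 3" using z0 by (simp add: add_nonneg_pos)
    have "(s / (8 * b\<^sup>2)) * ((g i) ^ 4 * (x i)\<^sup>2) \<le> (s / (8 * b\<^sup>2)) * ((g i) ^ 4 * b\<^sup>2)"
      using s g[OF i] x_square_le[OF i] by (intro mult_left_mono) auto
    also have "\<dots> = (g i) ^ 4 * s / 8" using b by simp
    also have "\<dots> \<le> (g i) ^ 4 * s / ((g i)\<^sup>2 + z) ^ 3"
      using p q s by (intro divide_left_mono) auto
    also have "\<dots> \<le> - (2 * (g i) ^ 4 * (z * (x i)\<^sup>2 - s) / ((g i)\<^sup>2 + z) ^ 3)"
    proof -
      have "(g i) ^ 4 * s \<le> - (2 * (g i) ^ 4 * (z * (x i)\<^sup>2 - s))"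
        using mult_left_mono[OF n, of "2 * (g i) ^ 4"] by (simp add: algebra_simps)
      then have "(g i) ^ 4 * s / ((g i)\<^sup>2 + z) ^ 3 \<le> - (2 * (g i) ^ 4 * (z * (x i)\<^sup>2 - s)) / ((g i)\<^sup>2 + z) ^ 3"
        using q by (intro divide_right_mono) auto
      then show ?thesis by simp
    qed
    finally show ?thesis by simp
  qed
  then have "(\<Sum>i<m. 2 * (g i) ^ 4 * (z * (x i)\<^sup>2 - s) / ((g i)\<^sup>2 + z) ^ 3)
      \<le> - (s / (8 * b\<^sup>2)) * (\<Sum>i<m. (g i) ^ 4 * (x i)\<^sup>2)"
    unfolding sum_distrib_left by (intro sum_mono) auto
  also have "\<dots> \<le> - (s / (8 * b\<^sup>2)) * (c * real m)"
    using c(2) s by (intro mult_left_mono_neg) auto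
  finally have D: "(\<Sum>i<m. 2 * (g i) ^ 4 * (z * (x i)\<^sup>2 - s) / ((g i)\<^sup>2 + z) ^ 3)
      \<le> - (s * c * real m / (8 * b\<^sup>2))" by simp
  have E: "0 \<le> s * c * real m / (8 * b\<^sup>2)" using s c by simp
  have "spectral_risk m s g x \<rho> - spectral_risk m s g x \<alpha> \<le> (\<rho> - \<alpha>) * - (s * c * real m / (8 * b\<^sup>2))"
    unfolding z(3) using D z by (intro mult_left_mono) auto
  also have "\<dots> \<le> (\<rho> / 2) * - (s * c * real m / (8 * b\<^sup>2))"
    using E \<alpha> by (intro mult_right_mono_neg) auto
  finally show ?thesis by (simp add: algebra_simps)
qed

text \<open>For z at least R the denominator lies between \<open>z^3\<close> and
  \<open>(2 z)^3\<close>. The bias part of the derivative is then at least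
  \<open>c m / (4 z^2)\<close>, and \<open>16 s \<le> c R\<close> makes the variance part consume at
  most half of it. The rise from R to 2 R already yields the gap; beyond 2 R only monotonicity is
  needed.\<close>

lemma risk_near_infinity:
  assumes c: "0 < c" "c * real m \<le> (\<Sum>i<m. (g i) ^ 4 * (x i)\<^sup>2)"
    and R: "1 \<le> R" "16 * s \<le> c * R" and \<alpha>: "2 * R \<le> \<alpha>"
  shows "spectral_risk m s g x R + real m * (c / (32 * R)) \<le> spectral_risk m s g x \<alpha>"
proof -
  have D: "c * real m / (8 * z\<^sup>2) \<le> (\<Sum>i<m. 2 * (g i) ^ 4 * (z * (x i)\<^sup>2 - s) / ((g i)\<^sup>2 + z) ^ 3)"
    if "R \<le> z" for z
  proof -
    have z: "1 \<le> z" "0 < z" using R that by auto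
    have tm: "(1 / (4 * z\<^sup>2)) * ((g i) ^ 4 * (x i)\<^sup>2) - 2 * s / z ^ 3
        \<le> 2 * (g i) ^ 4 * (z * (x i)\<^sup>2 - s) / ((g i)\<^sup>2 + z) ^ 3" if i: "i < m" for i
    proof -
      have q: "0 < ((g i)\<^sup>2 + z) ^ 3" using z by (simp add: add_nonneg_pos)
      have p: "((g i)\<^sup>2 + z) ^ 3 \<le> (2 * z) ^ 3" "z ^ 3 \<le> ((g i)\<^sup>2 + z) ^ 3"
        using g_power_le[OF i, of 2] z by (intro power_mono; simp)+
      have "(1 / (4 * z\<^sup>2)) * ((g i) ^ 4 * (x i)\<^sup>2) = 2 * (g i) ^ 4 * (z * (x i)\<^sup>2) / (2 * z) ^ 3"
        using z by (simp add: field_simps power2_eq_square power3_eq_cube)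
      also have "\<dots> \<le> 2 * (g i) ^ 4 * (z * (x i)\<^sup>2) / ((g i)\<^sup>2 + z) ^ 3"
        using p q z by (intro divide_left_mono) auto
      finally have 1: "(1 / (4 * z\<^sup>2)) * ((g i) ^ 4 * (x i)\<^sup>2)
          \<le> 2 * (g i) ^ 4 * (z * (x i)\<^sup>2) / ((g i)\<^sup>2 + z) ^ 3" .
      have "2 * (g i) ^ 4 * s \<le> 2 * 1 * s" using g_power_le[OF i, of 4] s by (intro mult_mono) auto
      then have 2: "2 * (g i) ^ 4 * s / ((g i)\<^sup>2 + z) ^ 3 \<le> 2 * s / z ^ 3"
        using p q z s by (intro frac_le) auto
      have "2 * (g i) ^ 4 * (z * (x i)\<^sup>2 - s) / ((g i)\<^sup>2 + z) ^ 3
        = 2 * (g i) ^ 4 * (z * (x i)\<^sup>2) / ((g i)\<^sup>2 + z) ^ 3 - 2 * (g i) ^ 4 * s / ((g i)\<^sup>2 + z) ^ 3"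
        by (simp add: right_diff_distrib diff_divide_distrib)
      then show ?thesis using 1 2 by simp
    qed
    have "2 * s / z ^ 3 \<le> c / (8 * z\<^sup>2)"
    proof -
      have "16 * s \<le> c * z" using R(2) that c(1) by (smt (verit) mult_left_mono)
      then show ?thesis using z by (simp add: field_simps power2_eq_square power3_eq_cube)
    qed
    then have "real m * (2 * s / z ^ 3) \<le> real m * (c / (8 * z\<^sup>2))" by (intro mult_left_mono) auto
    moreover have "(1 / (4 * z\<^sup>2)) * (c * real m) = c * real m / (8 * z\<^sup>2) + real m * (c / (8 * z\<^sup>2))"
      using z by (simp add: field_simps)
    ultimately have "c * real m / (8 * z\<^sup>2) \<le> (1 / (4 * z\<^sup>2)) * (c * real m) - real m * (2 * s / z ^ 3)"
      by linarith
    also have "\<dots> \<le> (1 / (4 * z\<^sup>2)) * (\<Sum>i<m. (g i) ^ 4 * (x i)\<^sup>2) - real m * (2 * s / z ^ 3)"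
      using c(2) by (intro diff_right_mono mult_left_mono) auto
    also have "\<dots> = (\<Sum>i<m. (1 / (4 * z\<^sup>2)) * ((g i) ^ 4 * (x i)\<^sup>2) - 2 * s / z ^ 3)"
      by (simp add: sum_subtractf sum_distrib_left)
    also have "\<dots> \<le> (\<Sum>i<m. 2 * (g i) ^ 4 * (z * (x i)\<^sup>2 - s) / ((g i)\<^sup>2 + z) ^ 3)"
      using tm by (intro sum_mono) auto
    finally show ?thesis .
  qed
  \<comment> \<open>The lower bound on the derivative decreases in z, so its value at the right
    endpoint serves for the whole interval.\<close>
  have up: "(\<beta> - \<alpha>) * (c * real m / (8 * \<beta>\<^sup>2)) \<le> spectral_risk m s g x \<beta> - spectral_risk m s g x \<alpha>"
    if "R \<le> \<alpha>" "\<alpha> \<le> \<beta>" for \<alpha> \<beta>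
  proof (cases "\<alpha> = \<beta>")
    case False
    then have "0 < \<alpha>" "\<alpha> < \<beta>" using that R(1) by auto
    then obtain z where z: "\<alpha> < z" "z < \<beta>" "spectral_risk m s g x \<beta> - spectral_risk m s g x \<alpha>
      = (\<beta> - \<alpha>) * (\<Sum>i<m. 2 * (g i) ^ 4 * (z * (x i)\<^sup>2 - s) / ((g i)\<^sup>2 + z) ^ 3)"
      by (rule spectral_risk_mvt)
    have "c * real m / (8 * \<beta>\<^sup>2) \<le> c * real m / (8 * z\<^sup>2)"
      using z that R c by (intro divide_left_mono mult_left_mono power_mono mult_pos_pos) auto
    also have "\<dots> \<le> (\<Sum>i<m. 2 * (g i) ^ 4 * (z * (x i)\<^sup>2 - s) / ((g i)\<^sup>2 + z) ^ 3)"
      using D[of z] z that by simp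
    finally show ?thesis unfolding z(3) using that by (intro mult_left_mono) auto
  qed simp
  have "R * (c * real m / (8 * (2 * R)\<^sup>2)) = real m * (c / (32 * R))"
    using R(1) by (simp add: field_simps power2_eq_square)
  then have "real m * (c / (32 * R)) \<le> spectral_risk m s g x (2 * R) - spectral_risk m s g x R"
    using up[of R "2 * R"] R(1) by simp
  moreover have "0 \<le> (\<alpha> - 2 * R) * (c * real m / (8 * \<alpha>\<^sup>2))" using c \<alpha> by simp
  then have "0 \<le> spectral_risk m s g x \<alpha> - spectral_risk m s g x (2 * R)"
    using up[of "2 * R" \<alpha>] R(1) \<alpha> by simp
  ultimately show ?thesis by simp
qed

end

text \<open>The interval, the gap and the two comparison points are fixed before m, the singular
  values and the coefficients. Fixed comparison points, one for each end, let the inequalities pass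
  to the limit function by pointwise convergence alone. The choice is \<open>C1 = \<rho> / 2\<close>
  with \<open>p1 = \<rho>\<close> and \<open>C2 = 2 * R\<close> with \<open>p2 = R\<close>, where
  \<rho> and R are dictated by the hypotheses of the two preceding lemmas.\<close>

lemma spectral_risk_coercive:
  assumes "0 < s" "0 < b" "0 < c"
  obtains C1 C2 \<kappa> p1 p2 where "0 < C1" "C1 < C2" "0 < \<kappa>" "p1 \<in> {C1..C2}" "p2 \<in> {C1..C2}"
    "\<And>m g x \<alpha>. spectral_bounds m s b g x \<Longrightarrow> c * real m \<le> (\<Sum>i<m. (g i) ^ 4 * (x i)\<^sup>2) \<Longrightarrow> 0 < \<alpha> \<Longrightarrow>
       (\<alpha> \<le> C1 \<longrightarrow> spectral_risk m s g x p1 + real m * \<kappa> \<le> spectral_risk m s g x \<alpha>) \<and>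
       (C2 \<le> \<alpha> \<longrightarrow> spectral_risk m s g x p2 + real m * \<kappa> \<le> spectral_risk m s g x \<alpha>)"
proof -
  define \<rho> where "\<rho> = min 1 (s / (2 * b\<^sup>2))"
  define R where "R = max 1 (16 * s / c)"
  define \<kappa> where "\<kappa> = min (\<rho> * s * c / (16 * b\<^sup>2)) (c / (32 * R))"
  have \<rho>: "0 < \<rho>" "\<rho> \<le> 1" "2 * \<rho> * b\<^sup>2 \<le> s"
  proof -
    show "0 < \<rho>" "\<rho> \<le> 1" using assms by (auto simp: \<rho>_def)
    have "\<rho> \<le> s / (2 * b\<^sup>2)" by (simp add: \<rho>_def)
    then show "2 * \<rho> * b\<^sup>2 \<le> s" using assms(2) by (simp add: field_simps)
  qed
  have R: "1 \<le> R" "16 * s \<le> c * R"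
  proof -
    have "16 * s / c \<le> R" by (simp add: R_def)
    then show "16 * s \<le> c * R" using assms(3) by (simp add: field_simps)
  qed (simp add: R_def)
  have \<kappa>: "0 < \<kappa>" using \<rho> R assms by (simp add: \<kappa>_def)
  show ?thesis
  proof (rule that[of "\<rho> / 2" "2 * R" \<kappa> \<rho> R])
    fix m g x \<alpha> assume B: "spectral_bounds m s b g x" and c: "c * real m \<le> (\<Sum>i<m. (g i) ^ 4 * (x i)\<^sup>2)"
      and \<alpha>: "0 < (\<alpha>::real)"
    interpret spectral_bounds m s b g x by fact
    have k: "real m * \<kappa> \<le> real m * (\<rho> * s * c / (16 * b\<^sup>2))" "real m * \<kappa> \<le> real m * (c / (32 * R))"
      by (intro mult_left_mono; simp add: \<kappa>_def)+
    show "(\<alpha> \<le> \<rho> / 2 \<longrightarrow> spectral_risk m s g x \<rho> + real m * \<kappa> \<le> spectral_risk m s g x \<alpha>) \<and>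
       (2 * R \<le> \<alpha> \<longrightarrow> spectral_risk m s g x R + real m * \<kappa> \<le> spectral_risk m s g x \<alpha>)"
      using risk_near_zero[OF assms(3) c \<rho> \<alpha>] risk_near_infinity[OF assms(3) c R, of \<alpha>] k by auto
  qed (use \<rho> R \<kappa> in auto)
qed

section \<open>Limits of minimizers\<close>

text \<open>The positive reals are exhausted by the compact intervals \<open>I n\<close>, away from
  0. Arzela-Ascoli applies on each, and a diagonal subsequence serves all of them at once.\<close>

lemma locally_lipschitz_convergent_subsequence:
  fixes h :: "nat \<Rightarrow> real \<Rightarrow> real"
  assumes bound: "\<And>n \<alpha>. 0 < \<alpha> \<Longrightarrow> \<bar>h n \<alpha>\<bar> \<le> B"
    and lip: "\<And>a n \<alpha> \<beta>. 0 < a \<Longrightarrow> a \<le> \<alpha> \<Longrightarrow> a \<le> \<beta> \<Longrightarrow> \<bar>h n \<alpha> - h n \<beta>\<bar> \<le> K a * \<bar>\<alpha> - \<beta>\<bar>"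
  obtains r f where "strict_mono (r :: nat \<Rightarrow> nat)" "continuous_on {0<..} f"
    "\<And>C1 C2. 0 < C1 \<Longrightarrow> uniform_limit {C1..C2} (\<lambda>k. h (r k)) f sequentially"
proof -
  define I where "I n = {1 / real (Suc n)..real (Suc n)}" for n
  have Ipos: "0 < \<alpha>" "1 / real (Suc n) \<le> \<alpha>" if "\<alpha> \<in> I n" for \<alpha> n
  proof -
    show "1 / real (Suc n) \<le> \<alpha>" using that by (simp add: I_def)
    moreover have "0 < 1 / real (Suc n)" by simp
    ultimately show "0 < \<alpha>" by linarith
  qed
  define P where "P n s = (\<exists>l. uniform_limit (I n) (\<lambda>k. h (s k)) l sequentially)" for n and s :: "nat \<Rightarrow> nat"
  interpret subseqs P
  proof
    fix n and s :: "nat \<Rightarrow> nat" assume "strict_mono s"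
    obtain l k where "strict_mono (k :: nat \<Rightarrow> nat)"
      and l: "\<And>e. 0 < e \<Longrightarrow> \<exists>N. \<forall>i \<alpha>. i \<ge> N \<and> \<alpha> \<in> I n \<longrightarrow> norm (h (s (k i)) \<alpha> - l \<alpha>) < e"
    proof (rule Arzela_Ascoli[of "I n" "\<lambda>i. h (s i)" B])
      show "compact (I n)" by (simp add: I_def)
      show "norm (h (s i) \<alpha>) \<le> B" if "\<alpha> \<in> I n" for i \<alpha> using bound Ipos that by simp
      fix \<alpha> and e :: real assume \<alpha>: "\<alpha> \<in> I n" and e: "0 < e"
      define L where "L = \<bar>K (1 / real (Suc n))\<bar> + 1"
      have L: "0 < L" by (simp add: L_def)
      show "\<exists>d>0. \<forall>i \<beta>. \<beta> \<in> I n \<and> norm (\<alpha> - \<beta>) < d \<longrightarrow> norm (h (s i) \<alpha> - h (s i) \<beta>) < e"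
      proof (intro exI[of _ "e / L"] conjI allI impI)
        show "0 < e / L" using e L by simp
        fix i \<beta> assume \<beta>: "\<beta> \<in> I n \<and> norm (\<alpha> - \<beta>) < e / L"
        have "norm (h (s i) \<alpha> - h (s i) \<beta>) \<le> K (1 / real (Suc n)) * \<bar>\<alpha> - \<beta>\<bar>"
          using lip[of "1 / real (Suc n)" \<alpha> \<beta> "s i"] Ipos(2) \<alpha> \<beta> by simp
        also have "\<dots> \<le> L * \<bar>\<alpha> - \<beta>\<bar>" by (intro mult_right_mono) (auto simp: L_def)
        also have "\<dots> < e" using \<beta> L by (simp add: field_simps)
        finally show "norm (h (s i) \<alpha> - h (s i) \<beta>) < e" .
      qed
    qed blast
    then have "uniform_limit (I n) (\<lambda>i. h (s (k i))) l sequentially"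
      unfolding uniform_limit_sequentially_iff dist_norm by meson
    then show "\<exists>r'. strict_mono r' \<and> P n (s \<circ> r')"
      using \<open>strict_mono k\<close> by (auto simp: P_def intro!: exI[of _ k])
  qed
  define r where "r = diagseq"
  \<comment> \<open>The diagonal sequence is a subsequence of the n-th selection only after its
    first terms; the shift by \<open>Suc n\<close> accounts for this and is removed in
    \<open>l'\<close>.\<close>
  have "P n (diagseq \<circ> (+) (Suc n))" for n
  proof (rule diagseq_holds)
    fix t s :: "nat \<Rightarrow> nat" and n assume t: "strict_mono t" and "P n s"
    then obtain l where "uniform_limit (I n) (\<lambda>k. h (s k)) l sequentially" by (auto simp: P_def)
    then have "uniform_limit (I n) (\<lambda>k. h (s (t k))) l sequentially"
      using filterlim_compose[of _ _ sequentially t sequentially] filterlim_subseq[OF t] by blast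
    then show "P n (s \<circ> t)" by (auto simp: P_def)
  qed
  then have "\<exists>l. uniform_limit (I n) (\<lambda>k. h (r (Suc n + k))) l sequentially" for n
    by (simp add: P_def r_def)
  then obtain l where l: "\<And>n. uniform_limit (I n) (\<lambda>k. h (r (Suc n + k))) (l n) sequentially" by metis
  have l': "uniform_limit (I n) (\<lambda>k. h (r k)) (l n) sequentially" for n
  proof (rule uniform_limitI)
    fix e :: real assume "0 < e"
    then have "\<forall>\<^sub>F k in sequentially. \<forall>\<alpha>\<in>I n. dist (h (r (k + Suc n)) \<alpha>) (l n \<alpha>) < e"
      using uniform_limitD[OF l[of n]] by (simp add: add.commute)
    then show "\<forall>\<^sub>F k in sequentially. \<forall>\<alpha>\<in>I n. dist (h (r k) \<alpha>) (l n \<alpha>) < e"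
      by (rule eventually_sequentially_seg[THEN iffD1])
  qed
  \<comment> \<open>The pointwise limit glues the limits \<open>l n\<close>, which agree wherever
    the intervals overlap.\<close>
  define f where "f \<alpha> = lim (\<lambda>k. h (r k) \<alpha>)" for \<alpha>
  have f: "f \<alpha> = l n \<alpha>" if "\<alpha> \<in> I n" for n \<alpha>
    unfolding f_def using tendsto_uniform_limitI[OF l' that] by (rule limI)
  have uf: "uniform_limit (I n) (\<lambda>k. h (r k)) f sequentially" for n
    using l'[of n] f by (subst uniform_limit_cong') auto
  have sub: "\<exists>n. {C1..C2} \<subseteq> I n" if "0 < C1" for C1 C2
  proof -
    obtain n where n: "max (1 / C1) C2 < real n" using reals_Archimedean2 by blast
    have "1 / C1 \<le> real (Suc n)" "C2 \<le> real (Suc n)" using n by auto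
    then have "1 / real (Suc n) \<le> C1" using that by (simp add: field_simps)
    then show ?thesis using \<open>C2 \<le> real (Suc n)\<close> unfolding I_def by (intro exI[of _ n]) auto
  qed
  have ul: "uniform_limit {C1..C2} (\<lambda>k. h (r k)) f sequentially" if "0 < C1" for C1 C2
    using sub[OF that, of C2] uf uniform_limit_on_subset by blast
  show ?thesis
  proof (rule that[of r f])
    show "strict_mono r" unfolding r_def by (rule subseq_diagseq)
    show "continuous_on {0<..} f"
    proof (rule continuous_at_imp_continuous_on, rule ballI)
      fix \<alpha> :: real assume "\<alpha> \<in> {0<..}"
      then have \<alpha>: "0 < \<alpha>" by simp
      have "continuous_on {\<alpha>/2..2*\<alpha>} (h n)" for n
        by (rule lipschitz_on_continuous_on[of "\<bar>K (\<alpha>/2)\<bar>"], rule lipschitz_onI)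
           (use lip[of "\<alpha>/2" _ _ n] \<alpha> in \<open>auto simp: dist_real_def intro!: order.trans[OF lip[of "\<alpha>/2"]] mult_right_mono\<close>)
      then have "continuous_on {\<alpha>/2..2*\<alpha>} f"
        using ul[of "\<alpha>/2" "2*\<alpha>"] \<alpha> by (intro uniform_limit_theorem[where F=sequentially and f="\<lambda>k. h (r k)"]) auto
      then show "isCont f \<alpha>" using \<alpha> by (intro continuous_on_interior[of "{\<alpha>/2..2*\<alpha>}"]) auto
    qed
  qed (rule ul)
qed

lemma ext_zero_cong:
  assumes "\<And>\<alpha>. 0 < \<alpha> \<Longrightarrow> p \<alpha> = q \<alpha>" "0 \<le> \<alpha>"
  shows "ext_zero p \<alpha> = ext_zero q \<alpha>"
proof -
  have "(p \<longlongrightarrow> l) (at_right 0) \<longleftrightarrow> (q \<longlongrightarrow> l) (at_right 0)" for l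
    by (rule filterlim_cong) (auto simp: eventually_at_filter assms(1))
  then show ?thesis using assms by (auto simp: ext_zero_def Topological_Spaces.Lim_def)
qed

lemma is_arg_min_cong:
  assumes "\<And>\<alpha>. P \<alpha> \<Longrightarrow> p \<alpha> = q \<alpha>"
  shows "is_arg_min p P \<alpha> \<longleftrightarrow> is_arg_min q P \<alpha>"
  using assms by (auto simp: is_arg_min_def)

text \<open>The common setting of the risk and of the risk estimator in a fixed dimension. Existence
  of a limit at 0 makes \<open>ext_zero\<close> meaningful there, and \<open>gap\<close> then
  excludes 0 as a minimizer.\<close>

locale coercive =
  fixes C1 C2 \<kappa> :: real and q :: "real \<Rightarrow> real"
  assumes C: "0 < C1" "C1 < C2" and \<kappa>: "0 < \<kappa>"
    and cont: "continuous_on {C1..C2} q"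
    and limit: "\<exists>L. (q \<longlongrightarrow> L) (at_right 0)"
    and gap: "\<And>\<alpha>. 0 < \<alpha> \<Longrightarrow> \<alpha> \<le> C1 \<or> C2 \<le> \<alpha> \<Longrightarrow> \<exists>p\<in>{C1..C2}. q p + \<kappa> \<le> q \<alpha>"
begin

lemma minimizer_compact:
  obtains z where "z \<in> {C1..C2}" "\<And>\<alpha>. \<alpha> \<in> {C1..C2} \<Longrightarrow> q z \<le> q \<alpha>"
proof -
  obtain z where "z \<in> {C1..C2}" "\<forall>\<alpha>\<in>{C1..C2}. q z \<le> q \<alpha>"
    using continuous_attains_inf[of "{C1..C2}" q] cont C by auto
  then show ?thesis using that by blast
qed

lemma ext_zero_minimizer:
  obtains z where "z \<in> {C1..C2}" "is_arg_min (ext_zero q) (\<lambda>\<alpha>. 0 \<le> \<alpha>) z"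
    and "ext_zero q z + \<kappa> \<le> ext_zero q 0"
proof -
  obtain z where z: "z \<in> {C1..C2}" "\<And>\<alpha>. \<alpha> \<in> {C1..C2} \<Longrightarrow> q z \<le> q \<alpha>"
    using minimizer_compact by blast
  have out: "q z + \<kappa> \<le> q \<alpha>" if "0 < \<alpha>" "\<alpha> \<le> C1 \<or> C2 \<le> \<alpha>" for \<alpha>
  proof -
    have "\<exists>p\<in>{C1..C2}. q p + \<kappa> \<le> q \<alpha>" using that by (rule gap)
    then obtain p where "p \<in> {C1..C2}" "q p + \<kappa> \<le> q \<alpha>" ..
    then show ?thesis using z(2)[of p] by linarith
  qed
  have le: "q z \<le> q \<alpha>" if "0 < \<alpha>" for \<alpha>
    using out[OF that] z(2)[of \<alpha>] \<kappa> by fastforce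
  obtain L where L: "(q \<longlongrightarrow> L) (at_right 0)" using limit ..
  then have "ext_zero q 0 = L" by (simp add: ext_zero_def tendsto_Lim)
  \<comment> \<open>All sufficiently small positive \<alpha> lie below \<open>C1\<close>, so the
    strict gap holds near 0 and survives in the limit.\<close>
  moreover have "q z + \<kappa> \<le> L"
  proof (rule tendsto_lowerbound[OF L])
    show "\<forall>\<^sub>F \<alpha> in at_right 0. q z + \<kappa> \<le> q \<alpha>"
      unfolding eventually_at_right_field using out C(1) by (intro exI[of _ C1]) auto
  qed simp
  moreover have "ext_zero q z = q z" using z(1) C(1) by (auto simp: ext_zero_def)
  ultimately have 0: "ext_zero q z + \<kappa> \<le> ext_zero q 0" by simp
  have "ext_zero q z \<le> ext_zero q \<alpha>" if "0 \<le> \<alpha>" for \<alpha>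
    using that le[of \<alpha>] 0 \<kappa> \<open>ext_zero q z = q z\<close> by (cases "\<alpha> = 0") (auto simp: ext_zero_def)
  then show ?thesis using that[OF z(1) _ 0] z(1) C(1) by (auto simp: is_arg_min_linorder)
qed

lemma arg_min_in_interval:
  assumes "is_arg_min (ext_zero q) (\<lambda>\<alpha>. 0 \<le> \<alpha>) \<alpha>"
  shows "C1 < \<alpha>" "\<alpha> < C2" "\<And>\<beta>. 0 < \<beta> \<Longrightarrow> q \<alpha> \<le> q \<beta>"
proof -
  obtain z where z: "z \<in> {C1..C2}" "ext_zero q z + \<kappa> \<le> ext_zero q 0"
    using ext_zero_minimizer by metis
  have min: "0 \<le> \<alpha>" "\<And>\<beta>. 0 \<le> \<beta> \<Longrightarrow> ext_zero q \<alpha> \<le> ext_zero q \<beta>"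
    using assms by (auto simp: is_arg_min_linorder)
  have "\<alpha> \<noteq> 0" using z min(2)[of z] C \<kappa> by auto
  then have pos: "0 < \<alpha>" using min(1) by simp
  show le: "q \<alpha> \<le> q \<beta>" if "0 < \<beta>" for \<beta>
    using min(2)[of \<beta>] pos that by (simp add: ext_zero_def)
  have "\<not> (\<alpha> \<le> C1 \<or> C2 \<le> \<alpha>)"
  proof
    assume "\<alpha> \<le> C1 \<or> C2 \<le> \<alpha>"
    then obtain p where "p \<in> {C1..C2}" "q p + \<kappa> \<le> q \<alpha>" using gap[OF pos] by auto
    moreover from this have "q \<alpha> \<le> q p" using C by (intro le) auto
    ultimately show False using \<kappa> by linarith
  qed
  then show "C1 < \<alpha>" "\<alpha> < C2" by auto
qed

end

text \<open>The asymptotic risk is a function on the positive reals without a value or an assumed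
  limit at 0, so it does not fit the locale \<open>coercive\<close>; the same compactness argument
  is run on the open half line.\<close>

lemma coercive_limit_minimizer:
  fixes f :: "real \<Rightarrow> real"
  assumes C: "0 < C1" "C1 < C2" and "0 < \<kappa>" and f: "continuous_on {0<..} f"
    and gap: "\<And>\<alpha>. 0 < \<alpha> \<Longrightarrow> \<alpha> \<le> C1 \<or> C2 \<le> \<alpha> \<Longrightarrow> \<exists>p\<in>{C1..C2}. f p + \<kappa> \<le> f \<alpha>"
  obtains z where "z \<in> {C1..C2}" "is_arg_min f (\<lambda>\<alpha>. 0 < \<alpha>) z"
proof -
  have "continuous_on {C1..C2} f" using f C by (rule_tac continuous_on_subset) auto
  then obtain z where z: "z \<in> {C1..C2}" "\<And>\<alpha>. \<alpha> \<in> {C1..C2} \<Longrightarrow> f z \<le> f \<alpha>"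
    using continuous_attains_inf[of "{C1..C2}" f] C by auto
  have "f z \<le> f \<alpha>" if \<alpha>: "0 < \<alpha>" for \<alpha>
  proof (cases "\<alpha> \<le> C1 \<or> C2 \<le> \<alpha>")
    case True
    then obtain p where "p \<in> {C1..C2}" "f p + \<kappa> \<le> f \<alpha>" using gap[OF \<alpha>] by auto
    then show ?thesis using z(2)[of p] \<open>0 < \<kappa>\<close> by linarith
  qed (use z(2) in auto)
  then show ?thesis using that[OF z(1)] z(1) C by (auto simp: is_arg_min_linorder)
qed

text \<open>On the compact set of points at distance at least \<delta> from all minimizers, f
  exceeds its minimum by some \<theta>. Uniform approximation within \<theta>/3 spends two thirds of
  it, one at each of the two points compared. Outside the interval the given gap takes over. A gap,
  rather than mere convergence, is what absorbs the random error of the estimator later.\<close>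

lemma uniform_gap_away_from_minimizers:
  fixes f :: "real \<Rightarrow> real" and h :: "nat \<Rightarrow> real \<Rightarrow> real"
  assumes C: "0 < C1" "C1 < C2" and \<kappa>: "0 < \<kappa>" and f: "continuous_on {0<..} f"
    and z0: "z0 \<in> {C1..C2}" "is_arg_min f (\<lambda>\<alpha>. 0 < \<alpha>) z0"
    and ul: "uniform_limit {C1..C2} h f sequentially"
    and gap: "\<forall>\<^sub>F k in sequentially. \<forall>\<alpha>>0. \<alpha> \<le> C1 \<or> C2 \<le> \<alpha> \<longrightarrow> (\<exists>p\<in>{C1..C2}. h k p + \<kappa> \<le> h k \<alpha>)"
    and \<delta>: "0 < \<delta>"
  obtains \<eta> where "0 < \<eta>" "\<forall>\<^sub>F k in sequentially. \<forall>\<alpha>>0.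
    \<alpha> \<le> C1 \<or> C2 \<le> \<alpha> \<or> (\<forall>a\<in>{a. is_arg_min f (\<lambda>\<alpha>. 0 < \<alpha>) a}. \<delta> \<le> \<bar>\<alpha> - a\<bar>)
      \<longrightarrow> (\<exists>p\<in>{C1..C2}. h k p + \<eta> \<le> h k \<alpha>)"
proof -
  let ?S = "{a. is_arg_min f (\<lambda>\<alpha>. 0 < \<alpha>) a}"
  define F where "F = {\<alpha>. \<forall>a\<in>?S. \<delta> \<le> \<bar>\<alpha> - a\<bar>}"
  have "F = (\<Inter>a\<in>?S. {\<alpha>. \<delta> \<le> \<bar>\<alpha> - a\<bar>})" by (auto simp: F_def)
  moreover have "closed {\<alpha>. \<delta> \<le> \<bar>\<alpha> - a\<bar>}" for a :: real
    by (intro closed_Collect_le continuous_intros)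
  ultimately have "closed F" by auto
  define K where "K = {C1..C2} \<inter> F"
  have K: "compact K" unfolding K_def using \<open>closed F\<close> by (simp add: compact_Int_closed)
  obtain \<theta> where \<theta>: "0 < \<theta>" "\<And>\<alpha>. \<alpha> \<in> K \<Longrightarrow> f z0 + \<theta> \<le> f \<alpha>"
  proof (cases "K = {}")
    case True
    then show ?thesis using that[of 1] by auto
  next
    case False
    have "continuous_on K f" using f C by (rule_tac continuous_on_subset) (auto simp: K_def)
    then obtain w where w: "w \<in> K" "\<And>\<alpha>. \<alpha> \<in> K \<Longrightarrow> f w \<le> f \<alpha>"
      using continuous_attains_inf[OF K False] by blast
    \<comment> \<open>A minimizer has distance 0 < \<delta> from itself and so cannot belong to
      \<open>F\<close>.\<close>
    have "0 < w" "w \<notin> ?S" using w(1) C \<delta> by (auto simp: K_def F_def)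
    then have "f z0 < f w" using z0(2) by (force simp: is_arg_min_def not_less)
    then show ?thesis using w(2) by (intro that[of "f w - f z0"]) auto
  qed
  define \<eta> where "\<eta> = min \<kappa> (\<theta> / 3)"
  have ev: "\<forall>\<^sub>F k in sequentially. \<forall>\<alpha>\<in>{C1..C2}. dist (h k \<alpha>) (f \<alpha>) < \<theta> / 3"
    using uniform_limitD[OF ul, of "\<theta> / 3"] \<theta>(1) by simp
  show ?thesis
  proof (rule that[of \<eta>])
    show "0 < \<eta>" using \<kappa> \<theta>(1) by (simp add: \<eta>_def)
    show "\<forall>\<^sub>F k in sequentially. \<forall>\<alpha>>0. \<alpha> \<le> C1 \<or> C2 \<le> \<alpha> \<or> (\<forall>a\<in>?S. \<delta> \<le> \<bar>\<alpha> - a\<bar>)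
      \<longrightarrow> (\<exists>p\<in>{C1..C2}. h k p + \<eta> \<le> h k \<alpha>)"
      using ev gap
    proof eventually_elim
      case (elim k)
      show ?case
      proof (intro allI impI)
        fix \<alpha> :: real
        assume \<alpha>: "0 < \<alpha>" and far: "\<alpha> \<le> C1 \<or> C2 \<le> \<alpha> \<or> (\<forall>a\<in>?S. \<delta> \<le> \<bar>\<alpha> - a\<bar>)"
        show "\<exists>p\<in>{C1..C2}. h k p + \<eta> \<le> h k \<alpha>"
        proof (cases "\<alpha> \<le> C1 \<or> C2 \<le> \<alpha>")
          case True
          then obtain p where "p \<in> {C1..C2}" "h k p + \<kappa> \<le> h k \<alpha>" using elim(2) \<alpha> by blast
          then show ?thesis by (intro bexI[of _ p]) (auto simp: \<eta>_def)
        next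
          case False
          then have aK: "\<alpha> \<in> K" using far by (auto simp: K_def F_def)
          then have "\<bar>h k \<alpha> - f \<alpha>\<bar> < \<theta> / 3" "\<bar>h k z0 - f z0\<bar> < \<theta> / 3"
            using elim(1) z0(1) by (auto simp: K_def dist_real_def)
          then have "h k z0 + \<theta> / 3 \<le> h k \<alpha>" using \<theta>(2)[OF aK] by linarith
          then show ?thesis using z0(1) by (intro bexI[of _ z0]) (auto simp: \<eta>_def)
        qed
      qed
    qed
  qed
qed

text \<open>Compactness gives a convergent subsequence of the minimizers. Uniform convergence allows
  the argument of \<open>h k\<close> to move with k, so the inequality with any competitor \<beta>
  passes to the limit.\<close>

lemma minimizers_converge:
  fixes f :: "real \<Rightarrow> real" and h :: "nat \<Rightarrow> real \<Rightarrow> real"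
  assumes C: "0 < C1" and f: "continuous_on {0<..} f"
    and ul: "\<And>C1 C2. 0 < C1 \<Longrightarrow> C1 < C2 \<Longrightarrow> uniform_limit {C1..C2} h f sequentially"
    and a: "\<forall>\<^sub>F k in sequentially. a k \<in> {C1..C2} \<and> (\<forall>\<beta>>0. h k (a k) \<le> h k \<beta>)"
  obtains s \<alpha> where "strict_mono (s :: nat \<Rightarrow> nat)" "is_arg_min f (\<lambda>\<alpha>. 0 < \<alpha>) \<alpha>" "(\<lambda>k. a (s k)) \<longlonglongrightarrow> \<alpha>"
proof -
  obtain N where N: "\<And>k. N \<le> k \<Longrightarrow> a k \<in> {C1..C2} \<and> (\<forall>\<beta>>0. h k (a k) \<le> h k \<beta>)"
    using a unfolding eventually_sequentially by blast
  have "\<forall>k. a (k + N) \<in> {C1..C2}" using N by simp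
  then obtain \<alpha> t where \<alpha>: "\<alpha> \<in> {C1..C2}" "strict_mono t" "((\<lambda>k. a (k + N)) \<circ> t) \<longlonglongrightarrow> \<alpha>"
    using compact_Icc[of C1 C2] unfolding compact_def by metis
  define s where "s k = t k + N" for k
  have s: "strict_mono s" using \<alpha>(2) by (auto simp: s_def strict_mono_def)
  have lim: "(\<lambda>k. a (s k)) \<longlonglongrightarrow> \<alpha>" using \<alpha>(3) by (simp add: s_def o_def)
  have "f \<alpha> \<le> f \<beta>" if "0 < \<beta>" for \<beta>
  proof -
    \<comment> \<open>The interval is enlarged so that uniform convergence covers the competitor
      \<beta> as well as the minimizers.\<close>
    define D1 D2 where "D1 = min C1 \<beta>" and "D2 = max (C2 + 1) (\<beta> + 1)"
    have D: "0 < D1" "D1 < D2" "{C1..C2} \<subseteq> {D1..D2}" "\<beta> \<in> {D1..D2}"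
      using C that by (auto simp: D1_def D2_def)
    have u: "uniform_limit {D1..D2} (\<lambda>k. h (s k)) f sequentially"
      using filterlim_compose[OF ul[OF D(1,2)] filterlim_subseq[OF s]] .
    have as: "a (s k) \<in> {D1..D2}" for k using N[of "s k"] D(3) by (auto simp: s_def)
    have "isCont f \<alpha>" using f \<alpha>(1) C by (auto simp: continuous_on_eq_continuous_at)
    then have "(\<lambda>k. f (a (s k))) \<longlonglongrightarrow> f \<alpha>" using lim by (rule isCont_tendsto_compose)
    moreover have "(\<lambda>k. h (s k) (a (s k)) - f (a (s k))) \<longlonglongrightarrow> 0"
    proof (rule tendstoI)
      fix e :: real assume "0 < e"
      from uniform_limitD[OF u this]
      show "\<forall>\<^sub>F k in sequentially. dist (h (s k) (a (s k)) - f (a (s k))) 0 < e"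
        by eventually_elim (use as in \<open>auto simp: dist_real_def\<close>)
    qed
    ultimately have "(\<lambda>k. h (s k) (a (s k))) \<longlonglongrightarrow> f \<alpha>"
      using tendsto_add by fastforce
    moreover have "(\<lambda>k. h (s k) \<beta>) \<longlonglongrightarrow> f \<beta>" using tendsto_uniform_limitI[OF u D(4)] .
    ultimately show ?thesis
      by (rule LIMSEQ_le) (use N that in \<open>auto simp: s_def\<close>)
  qed
  then have "is_arg_min f (\<lambda>\<alpha>. 0 < \<alpha>) \<alpha>" using \<alpha>(1) C by (auto simp: is_arg_min_linorder)
  with s lim show ?thesis using that by blast
qed

section \<open>The risk estimator\<close>

definition spectral_sure :: "nat \<Rightarrow> real \<Rightarrow> (nat \<Rightarrow> real) \<Rightarrow> (nat \<Rightarrow> real) \<Rightarrow> real \<Rightarrow> real" where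
  "spectral_sure m s g Y \<alpha> = (\<Sum>i<m. ((1 - shrinkage (g i) \<alpha>) * Y i)\<^sup>2) - real m * s
     + 2 * s * (\<Sum>i<m. shrinkage (g i) \<alpha>)"

text \<open>With u the filter factor, the correction terms of the estimator complete a square:
  \<open>s - 2 s u + s u^2 = (1 - u)^2 s\<close>. The difference therefore consists of the centred
  squares of the data when Y are the data coefficients, which shows that the estimator is
  unbiased.\<close>

lemma sure_minus_risk:
  "spectral_sure m s g Y \<alpha> - spectral_risk m s g x \<alpha>
    = (\<Sum>i<m. (1 - shrinkage (g i) \<alpha>)\<^sup>2 * ((Y i)\<^sup>2 - ((g i * x i)\<^sup>2 + s)))"
proof -
  have "real m * s = (\<Sum>i<m. s)" by simp
  then show ?thesis
    unfolding spectral_sure_def spectral_risk_def sum_distrib_left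
    by (simp only: sum.distrib[symmetric] sum_subtractf[symmetric])
       (intro sum.cong refl, simp add: power2_eq_square algebra_simps)
qed

text \<open>The hypothesis on the partial sums does not mention \<alpha>: one event controls the
  whole half line, where only the monotone weights change.\<close>

lemma sure_risk_uniform_deviation:
  assumes g: "\<And>i j. i \<le> j \<Longrightarrow> j < m \<Longrightarrow> g j \<le> g i" "\<And>i. i < m \<Longrightarrow> 0 \<le> g i"
    and D: "\<And>k. k \<le> m \<Longrightarrow> \<bar>\<Sum>i<k. (Y i)\<^sup>2 - ((g i * x i)\<^sup>2 + s)\<bar> \<le> t" and "0 < \<alpha>"
  shows "\<bar>spectral_sure m s g Y \<alpha> - spectral_risk m s g x \<alpha>\<bar> \<le> 2 * t"
  unfolding sure_minus_risk
proof (rule weighted_sum_le_partial_sums[OF _ _ _ D])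
  fix i assume "i < m"
  show "0 \<le> (1 - shrinkage (g i) \<alpha>)\<^sup>2" by simp
  show "(1 - shrinkage (g i) \<alpha>)\<^sup>2 \<le> 1"
    using shrinkage_bounds[OF assms(4), of "g i"] by (intro power_le_one) auto
next
  fix i j assume "i \<le> j" "j < m"
  then have "shrinkage (g j) \<alpha> \<le> shrinkage (g i) \<alpha>" using g assms(4) by (intro shrinkage_mono) auto
  then show "(1 - shrinkage (g i) \<alpha>)\<^sup>2 \<le> (1 - shrinkage (g j) \<alpha>)\<^sup>2"
    using shrinkage_bounds[OF assms(4), of "g i"] by (intro power_mono) auto
qed

section \<open>Limits as \<alpha> decreases to 0, and continuity in \<alpha>\<close>

lemma shrinkage_tendsto_zero:
  "((\<lambda>\<alpha>. shrinkage g \<alpha>) \<longlongrightarrow> (if g = 0 then 0 else 1)) (at_right 0)"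
proof (cases "g = 0")
  case False
  then have "((\<lambda>\<alpha>. g\<^sup>2 / (g\<^sup>2 + \<alpha>)) \<longlongrightarrow> g\<^sup>2 / (g\<^sup>2 + 0)) (at_right 0)" by (intro tendsto_intros) auto
  then show ?thesis using False by (simp add: shrinkage_def)
qed (simp add: shrinkage_def)

lemma continuous_on_shrinkage: "continuous_on {0<..} (shrinkage g)"
  unfolding shrinkage_def
  by (intro continuous_intros) (smt (verit) greaterThan_iff zero_le_power2)

lemma spectral_tendsto_zero:
  "\<exists>L. (spectral_risk m s g x \<longlongrightarrow> L) (at_right 0)" "\<exists>L. (spectral_sure m s g Y \<longlongrightarrow> L) (at_right 0)"
proof -
  have "(spectral_risk m s g x \<longlongrightarrow>
      (\<Sum>i<m. ((1 - (if g i = 0 then 0 else 1)) * (g i * x i))\<^sup>2 + (if g i = 0 then 0 else 1)\<^sup>2 * s)) (at_right 0)"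
    unfolding spectral_risk_def[abs_def] by (intro tendsto_intros shrinkage_tendsto_zero)
  then show "\<exists>L. (spectral_risk m s g x \<longlongrightarrow> L) (at_right 0)" ..
  have "(spectral_sure m s g Y \<longlongrightarrow>
      (\<Sum>i<m. ((1 - (if g i = 0 then 0 else 1)) * Y i)\<^sup>2) - real m * s
        + 2 * s * (\<Sum>i<m. if g i = 0 then 0 else 1)) (at_right 0)"
    unfolding spectral_sure_def[abs_def] by (intro tendsto_intros shrinkage_tendsto_zero)
  then show "\<exists>L. (spectral_sure m s g Y \<longlongrightarrow> L) (at_right 0)" ..
qed

lemma continuous_on_spectral:
  assumes "0 < C1"
  shows "continuous_on {C1..C2} (spectral_risk m s g x)" "continuous_on {C1..C2} (spectral_sure m s g Y)"
proof -
  have *: "continuous_on {C1..C2} (shrinkage h)" for h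
    by (rule continuous_on_subset[OF continuous_on_shrinkage]) (use assms in auto)
  show "continuous_on {C1..C2} (spectral_risk m s g x)" "continuous_on {C1..C2} (spectral_sure m s g Y)"
    unfolding spectral_risk_def[abs_def] spectral_sure_def[abs_def] by (intro continuous_intros *)+
qed

section \<open>Expectation and deviation of the spectral quantities under the noise\<close>

lemma (in isotropic_noise) mean_prediction_error:
  "(\<integral>\<omega>. (\<Sum>i<m. (d i - u i * e i \<omega>)\<^sup>2) \<partial>M) = (\<Sum>i<m. (d i)\<^sup>2 + (u i)\<^sup>2 * s)"
proof -
  have "has_bochner_integral M (\<lambda>\<omega>. (d i - u i * e i \<omega>)\<^sup>2) ((d i)\<^sup>2 + (u i)\<^sup>2 * s)" if "i < m" for i
  proof -
    have "has_bochner_integral M (\<lambda>\<omega>. (d i)\<^sup>2) ((d i)\<^sup>2)"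
      by (simp add: has_bochner_integral_iff prob_space)
    then have "has_bochner_integral M (\<lambda>\<omega>. (d i)\<^sup>2 - (2 * d i * u i) * e i \<omega> + (u i)\<^sup>2 * (e i \<omega>)\<^sup>2)
      ((d i)\<^sup>2 - (2 * d i * u i) * 0 + (u i)\<^sup>2 * s)"
      by (intro has_bochner_integral_add has_bochner_integral_diff has_bochner_integral_mult_right
          component_moments that)
    then show ?thesis by (simp add: power2_eq_square algebra_simps)
  qed
  then have "has_bochner_integral M (\<lambda>\<omega>. \<Sum>i<m. (d i - u i * e i \<omega>)\<^sup>2) (\<Sum>i<m. (d i)\<^sup>2 + (u i)\<^sup>2 * s)"
    by (intro has_bochner_integral_sum) auto
  then show ?thesis by (rule has_bochner_integral_integral_eq)
qed

text \<open>The bad event is the union of the Chebyshev events at the \<open>N + 1\<close> grid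
  points. Off it, \<open>partial_sums_le_grid\<close> covers every k, at the price of the mean mass
  \<open>(b^2 + s) L\<close> of one grid cell.\<close>

lemma (in isotropic_noise) max_deviation_event:
  assumes s: "0 \<le> s" and c: "\<And>i. i < m \<Longrightarrow> \<bar>c i\<bar> \<le> b" and "m \<le> N * L" and t: "0 < t"
  obtains E where "E \<in> events" "prob E \<le> real (N + 1) * ((4 * s\<^sup>2 + 8 * s * b\<^sup>2) * real m / t\<^sup>2)"
    "\<And>\<omega> k. \<omega> \<in> space M - E \<Longrightarrow> k \<le> m \<Longrightarrow>
      \<bar>\<Sum>i<k. (c i + e i \<omega>)\<^sup>2 - ((c i)\<^sup>2 + s)\<bar> \<le> t + (b\<^sup>2 + s) * real L"
proof -
  let ?D = "\<lambda>k \<omega>. \<Sum>i<k. (c i + e i \<omega>)\<^sup>2 - ((c i)\<^sup>2 + s)"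
  define F where "F j = {\<omega>\<in>space M. t \<le> \<bar>?D (min (j * L) m) \<omega>\<bar>}" for j
  have meas: "?D k \<in> borel_measurable M" if "k \<le> m" for k
    using that by (intro borel_measurable_sum borel_measurable_diff borel_measurable_power
      borel_measurable_add component_measurable) auto
  have F: "F j \<in> events" for j
    unfolding F_def using meas[of "min (j * L) m"] by measurable
  have c2: "(c i)\<^sup>2 \<le> b\<^sup>2" if "i < m" for i
    using c[OF that] by (metis abs_le_square_iff abs_of_nonneg abs_ge_zero order.trans)
  show ?thesis
  proof (rule that[of "\<Union>j\<in>{..N}. F j"])
    show "(\<Union>j\<in>{..N}. F j) \<in> events" using F by auto
    have "prob (\<Union>j\<in>{..N}. F j) \<le> (\<Sum>j\<in>{..N}. prob (F j))"
      using F by (intro finite_measure_subadditive_finite) auto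
    also have "\<dots> \<le> (\<Sum>j\<in>{..N}. (4 * s\<^sup>2 + 8 * s * b\<^sup>2) * real m / t\<^sup>2)"
    proof (rule sum_mono)
      fix j
      have "prob (F j) \<le> (4 * s\<^sup>2 + 8 * s * b\<^sup>2) * real (min (j * L) m) / t\<^sup>2"
        unfolding F_def using c by (intro data_square_partial_sum_deviation[OF _ t s]) auto
      also have "\<dots> \<le> (4 * s\<^sup>2 + 8 * s * b\<^sup>2) * real m / t\<^sup>2"
        using s by (intro divide_right_mono mult_left_mono) auto
      finally show "prob (F j) \<le> (4 * s\<^sup>2 + 8 * s * b\<^sup>2) * real m / t\<^sup>2" .
    qed
    finally show "prob (\<Union>j\<in>{..N}. F j) \<le> real (N + 1) * ((4 * s\<^sup>2 + 8 * s * b\<^sup>2) * real m / t\<^sup>2)"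
      by simp
  next
    fix \<omega> k assume \<omega>: "\<omega> \<in> space M - (\<Union>j\<in>{..N}. F j)" and "k \<le> m"
    show "\<bar>?D k \<omega>\<bar> \<le> t + (b\<^sup>2 + s) * real L"
    proof (rule partial_sums_le_grid[OF _ _ _ _ assms(3) \<open>k \<le> m\<close>])
      fix j assume "j \<le> N"
      then show "\<bar>?D (min (j * L) m) \<omega>\<bar> \<le> t" using \<omega> by (fastforce simp: F_def)
    qed (use s c2 in auto)
  qed
qed

section \<open>Transfer from matrices to spectral sums, and location of the minimizers of the
  estimator\<close>

lemma mspe_svd:
  assumes svd: "singular_system m A U \<gamma> V" and "prob_space M" "0 < \<sigma>" "gaussian_noise M m \<sigma> \<epsilon>"
    and x: "x \<in> carrier_vec m" and y: "\<And>\<omega>. \<omega> \<in> space M \<Longrightarrow> y \<omega> = A *\<^sub>v x + \<epsilon> \<omega>" and "0 \<le> \<alpha>"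
  shows "mspe M A x y \<alpha> = ext_zero (spectral_risk m (\<sigma>\<^sup>2) \<gamma> (\<lambda>i. col V i \<bullet> x)) \<alpha>"
  unfolding mspe_def
proof (rule ext_zero_cong[OF _ \<open>0 \<le> \<alpha>\<close>])
  fix \<beta> :: real assume \<beta>: "0 < \<beta>"
  interpret isotropic_noise M m "\<sigma>\<^sup>2" "\<lambda>i \<omega>. col U i \<bullet> \<epsilon> \<omega>"
    by (rule gaussian_noise_isotropic[OF assms(2-4) singular_system_facts(1)[OF svd]])
  have car: "\<epsilon> \<omega> \<in> carrier_vec m" if "\<omega> \<in> space M" for \<omega>
    using assms(4) that by (simp add: gaussian_noise_def)
  have "(\<integral>\<omega>. (vec_norm2 (A *\<^sub>v (x - tikhonov A \<beta> (y \<omega>))))\<^sup>2 \<partial>M)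
    = (\<integral>\<omega>. (\<Sum>i<m. ((1 - shrinkage (\<gamma> i) \<beta>) * (\<gamma> i * (col V i \<bullet> x))
        - shrinkage (\<gamma> i) \<beta> * (col U i \<bullet> \<epsilon> \<omega>))\<^sup>2) \<partial>M)"
    by (rule Bochner_Integration.integral_cong[OF refl]) (simp add: y prediction_error_svd[OF svd \<beta> x car])
  then show "(\<integral>\<omega>. (vec_norm2 (A *\<^sub>v (x - tikhonov A \<beta> (y \<omega>))))\<^sup>2 \<partial>M)
    = spectral_risk m (\<sigma>\<^sup>2) \<gamma> (\<lambda>i. col V i \<bullet> x) \<beta>"
    by (simp add: mean_prediction_error spectral_risk_def)
qed

lemma psure_svd:
  assumes svd: "singular_system m A U \<gamma> V" and w: "w \<in> carrier_vec m" and "0 \<le> \<alpha>"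
  shows "psure A \<sigma> w \<alpha> = ext_zero (spectral_sure m (\<sigma>\<^sup>2) \<gamma> (\<lambda>i. col U i \<bullet> w)) \<alpha>"
  unfolding psure_def
proof (rule ext_zero_cong[OF _ \<open>0 \<le> \<alpha>\<close>])
  note f = singular_system_facts[OF svd]
  fix \<beta> :: real assume \<beta>: "0 < \<beta>"
  have "dim_row A = m" using f(5) by simp
  then show "(vec_norm2 (w - A *\<^sub>v tikhonov A \<beta> w))\<^sup>2 - real (dim_row A) * \<sigma>\<^sup>2
       + 2 * \<sigma>\<^sup>2 * mat_trace (A * tikhonov_mat A \<beta>) = spectral_sure m (\<sigma>\<^sup>2) \<gamma> (\<lambda>i. col U i \<bullet> w) \<beta>"
    unfolding residual_svd[OF svd \<beta> w] forward_tikhonov_mat_svd[OF svd \<beta>] mat_trace_sandwich[OF f(1)]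
    by (simp add: spectral_sure_def)
qed

text \<open>A deterministic perturbation argument: replacing the risk by the estimator costs \<tau>
  at each of the two points compared, so a gap \<kappa> > 2 \<tau> survives. The predicate
  \<open>far\<close> is left abstract to treat at once the ends of the half line and the points away
  from the minimizers of f.\<close>

lemma sure_minimizer_location:
  assumes C: "0 < C1" "C1 < C2" and far: "\<And>\<alpha>. \<alpha> \<le> C1 \<or> C2 \<le> \<alpha> \<Longrightarrow> far \<alpha>"
    and gap: "\<And>\<alpha>. 0 < \<alpha> \<Longrightarrow> far \<alpha> \<Longrightarrow> \<exists>p\<in>{C1..C2}. spectral_risk m s g x p + \<kappa> \<le> spectral_risk m s g x \<alpha>"
    and dev: "\<And>\<alpha>. 0 < \<alpha> \<Longrightarrow> \<bar>spectral_sure m s g Y \<alpha> - spectral_risk m s g x \<alpha>\<bar> \<le> \<tau>" and \<tau>: "2 * \<tau> < \<kappa>"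
  shows "\<exists>\<alpha>. is_arg_min (ext_zero (spectral_sure m s g Y)) (\<lambda>\<alpha>. 0 \<le> \<alpha>) \<alpha>"
    and "is_arg_min (ext_zero (spectral_sure m s g Y)) (\<lambda>\<alpha>. 0 \<le> \<alpha>) \<alpha> \<Longrightarrow> \<not> far \<alpha>"
proof -
  let ?q = "spectral_sure m s g Y"
  have qgap: "\<exists>p\<in>{C1..C2}. ?q p + (\<kappa> - 2 * \<tau>) \<le> ?q \<alpha>" if "0 < \<alpha>" "far \<alpha>" for \<alpha>
  proof -
    obtain p where p: "p \<in> {C1..C2}" "spectral_risk m s g x p + \<kappa> \<le> spectral_risk m s g x \<alpha>"
      using gap[OF \<open>0 < \<alpha>\<close> \<open>far \<alpha>\<close>] by blast
    then have "0 < p" using C by auto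
    then have "?q p + (\<kappa> - 2 * \<tau>) \<le> ?q \<alpha>" using dev[OF \<open>0 < \<alpha>\<close>] dev[of p] p(2) by linarith
    then show ?thesis using p(1) by blast
  qed
  interpret coercive C1 C2 "\<kappa> - 2 * \<tau>" ?q
    using C \<tau> far qgap continuous_on_spectral(2)[OF C(1)] spectral_tendsto_zero(2)
    by unfold_locales auto
  show "\<exists>\<alpha>. is_arg_min (ext_zero ?q) (\<lambda>\<alpha>. 0 \<le> \<alpha>) \<alpha>" using ext_zero_minimizer by metis
  assume m: "is_arg_min (ext_zero ?q) (\<lambda>\<alpha>. 0 \<le> \<alpha>) \<alpha>"
  note a = arg_min_in_interval[OF m]
  show "\<not> far \<alpha>"
  proof
    assume "far \<alpha>"
    moreover have "0 < \<alpha>" using a(1) C by simp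
    ultimately obtain p where p: "p \<in> {C1..C2}" "?q p + (\<kappa> - 2 * \<tau>) \<le> ?q \<alpha>" using qgap by blast
    then show False using a(3)[of p] C \<tau> by auto
  qed
qed

theorem theorem3:
  fixes \<sigma> :: real
    and M :: "nat \<Rightarrow> 'a measure"
    and A U V :: "nat \<Rightarrow> real mat"
    and \<gamma> :: "nat \<Rightarrow> nat \<Rightarrow> real"
    and x :: "nat \<Rightarrow> real vec"
    and \<epsilon> y :: "nat \<Rightarrow> 'a \<Rightarrow> real vec"
    and \<alpha>_mspe :: "nat \<Rightarrow> real"
    and \<alpha>_psure :: "nat \<Rightarrow> 'a \<Rightarrow> real"
  assumes sigma_pos: "0 < \<sigma>"
    and prob: "\<And>m. 1 \<le> m \<Longrightarrow> prob_space (M m)"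
    and noise: "\<And>m. 1 \<le> m \<Longrightarrow> gaussian_noise (M m) m \<sigma> (\<epsilon> m)"
    and x_dim: "\<And>m. 1 \<le> m \<Longrightarrow> x m \<in> carrier_vec m"
    and model: "\<And>m \<omega>. 1 \<le> m \<Longrightarrow> \<omega> \<in> space (M m) \<Longrightarrow> y m \<omega> = A m *\<^sub>v x m + \<epsilon> m \<omega>"
    and svd: "\<And>m. 1 \<le> m \<Longrightarrow> singular_system m (A m) (U m) (\<gamma> m) (V m)"
    and gamma_first: "\<And>m. 1 \<le> m \<Longrightarrow> \<gamma> m 0 = 1"
    and coeff_bounded: "\<exists>B. \<forall>m\<ge>1. \<forall>i<m. \<bar>col (V m) i \<bullet> x m\<bar> \<le> B"
    and away_from_zero:
      "\<exists>c>0. \<forall>m\<ge>1. c \<le> (1 / real m) * (\<Sum>i<m. (\<gamma> m i) ^ 4 * (col (V m) i \<bullet> x m)\<^sup>2)"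
    and mspe_min:
      "\<And>m. 1 \<le> m \<Longrightarrow> is_arg_min (mspe (M m) (A m) (x m) (y m)) (\<lambda>\<alpha>. 0 \<le> \<alpha>) (\<alpha>_mspe m)"
    and psure_rv: "\<And>m. 1 \<le> m \<Longrightarrow> \<alpha>_psure m \<in> borel_measurable (M m)"
    and psure_min:
      "\<And>m. 1 \<le> m \<Longrightarrow> AE \<omega> in M m.
         (\<exists>\<alpha>. is_arg_min (psure (A m) \<sigma> (y m \<omega>)) (\<lambda>\<alpha>. 0 \<le> \<alpha>) \<alpha>) \<longrightarrow>
         is_arg_min (psure (A m) \<sigma> (y m \<omega>)) (\<lambda>\<alpha>. 0 \<le> \<alpha>) (\<alpha>_psure m \<omega>)"
  shows "(\<exists>r f. asymptotic_risk (\<lambda>m. mspe (M m) (A m) (x m) (y m)) r f) \<and>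
    (\<forall>r f. asymptotic_risk (\<lambda>m. mspe (M m) (A m) (x m) (y m)) r f \<longrightarrow>
      (\<exists>s \<alpha>. strict_mono s \<and> is_arg_min f (\<lambda>\<alpha>. 0 < \<alpha>) \<alpha> \<and>
         (\<lambda>k. \<alpha>_mspe (r (s k))) \<longlonglongrightarrow> \<alpha>) \<and>
      converges_in_prob_to_set (\<lambda>k. M (r k)) (\<lambda>k. \<alpha>_psure (r k))
        {\<alpha>. is_arg_min f (\<lambda>\<alpha>. 0 < \<alpha>) \<alpha>})"
proof -
  define X where "X m i = col (V m) i \<bullet> x m" for m i
  define R where "R m = spectral_risk m (\<sigma>\<^sup>2) (\<gamma> m) (X m)" for m
  define h where "h m \<alpha> = mspe (M m) (A m) (x m) (y m) \<alpha> / real m" for m \<alpha>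
  obtain B where B: "\<And>m i. 1 \<le> m \<Longrightarrow> i < m \<Longrightarrow> \<bar>X m i\<bar> \<le> B" using coeff_bounded unfolding X_def by blast
  \<comment> \<open>The maximum with 1 provides the positive bound that
    \<open>spectral_bounds\<close> requires.\<close>
  define b where "b = max B 1"
  obtain c where c: "0 < c" "\<And>m. 1 \<le> m \<Longrightarrow> c * real m \<le> (\<Sum>i<m. (\<gamma> m i) ^ 4 * (X m i)\<^sup>2)"
    using away_from_zero by (auto simp: X_def field_simps)
  have \<gamma>: "\<gamma> m j \<le> \<gamma> m i" "0 \<le> \<gamma> m j" "\<gamma> m j \<le> 1" if "1 \<le> m" "i \<le> j" "j < m" for m i j
    using svd[OF that(1)] that gamma_first[OF that(1)] unfolding singular_system_def by (metis le0)+
  have bounds: "spectral_bounds m (\<sigma>\<^sup>2) b (\<gamma> m) (X m)" if "1 \<le> m" for m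
    using sigma_pos \<gamma>[OF that order_refl] B[OF that] by unfold_locales (auto simp: b_def le_max_iff_disj)
  have mspe_eq: "mspe (M m) (A m) (x m) (y m) \<alpha> = ext_zero (R m) \<alpha>" if "1 \<le> m" "0 \<le> \<alpha>" for m \<alpha>
    unfolding R_def X_def
    using mspe_svd[OF svd[OF that(1)] prob[OF that(1)] sigma_pos noise[OF that(1)] x_dim[OF that(1)] model[OF that(1)]]
      that(2) by blast
  have h_eq: "h m \<alpha> = R m \<alpha> / real m" if "1 \<le> m" "0 < \<alpha>" for m \<alpha>
    using mspe_eq[of m \<alpha>] that by (simp add: h_def ext_zero_def)
  \<comment> \<open>The hypotheses start at m = 1. Division by 0 gives 0 in dimension 0, so the
    bounds for Arzela-Ascoli hold for every index.\<close>
  have h_zero: "h 0 \<alpha> = 0" for \<alpha> by (simp add: h_def)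
  have "0 < \<sigma>\<^sup>2" "0 < b" using sigma_pos by (auto simp: b_def)
  from spectral_risk_coercive[OF this c(1)]
  obtain C1 C2 \<kappa> p1 p2 where C: "0 < C1" "C1 < C2" and \<kappa>: "0 < \<kappa>"
    and p: "p1 \<in> {C1..C2}" "p2 \<in> {C1..C2}"
    and coerc: "\<And>m g x \<alpha>. spectral_bounds m (\<sigma>\<^sup>2) b g x \<Longrightarrow> c * real m \<le> (\<Sum>i<m. (g i) ^ 4 * (x i)\<^sup>2) \<Longrightarrow> 0 < \<alpha> \<Longrightarrow>
       (\<alpha> \<le> C1 \<longrightarrow> spectral_risk m (\<sigma>\<^sup>2) g x p1 + real m * \<kappa> \<le> spectral_risk m (\<sigma>\<^sup>2) g x \<alpha>) \<and>
       (C2 \<le> \<alpha> \<longrightarrow> spectral_risk m (\<sigma>\<^sup>2) g x p2 + real m * \<kappa> \<le> spectral_risk m (\<sigma>\<^sup>2) g x \<alpha>)"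
    by blast
  have Rgap: "\<alpha> \<le> C1 \<Longrightarrow> R m p1 + real m * \<kappa> \<le> R m \<alpha>" "C2 \<le> \<alpha> \<Longrightarrow> R m p2 + real m * \<kappa> \<le> R m \<alpha>"
    if "1 \<le> m" "0 < \<alpha>" for m \<alpha>
    using coerc[OF bounds[OF that(1)] c(2)[OF that(1)] that(2)] by (auto simp: R_def)
  have hgap: "\<alpha> \<le> C1 \<Longrightarrow> h m p1 + \<kappa> \<le> h m \<alpha>" "C2 \<le> \<alpha> \<Longrightarrow> h m p2 + \<kappa> \<le> h m \<alpha>"
    if "1 \<le> m" "0 < \<alpha>" for m \<alpha>
  proof -
    have "R m q / real m + \<kappa> \<le> R m \<alpha> / real m" if "R m q + real m * \<kappa> \<le> R m \<alpha>" for q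
      using divide_right_mono[OF that, of "real m"] \<open>1 \<le> m\<close> by (simp add: add_divide_distrib)
    then show "\<alpha> \<le> C1 \<Longrightarrow> h m p1 + \<kappa> \<le> h m \<alpha>" "C2 \<le> \<alpha> \<Longrightarrow> h m p2 + \<kappa> \<le> h m \<alpha>"
      using Rgap[OF that] that p C by (simp_all add: h_eq)
  qed
  have ex: "\<exists>r f. asymptotic_risk (\<lambda>m. mspe (M m) (A m) (x m) (y m)) r f"
  proof -
    have "\<bar>h m \<alpha>\<bar> \<le> b\<^sup>2 + \<sigma>\<^sup>2" if "0 < \<alpha>" for m \<alpha>
    proof (cases "m = 0")
      case False
      then have m: "1 \<le> m" by simp
      interpret spectral_bounds m "\<sigma>\<^sup>2" b "\<gamma> m" "X m" by (rule bounds[OF m])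
      show ?thesis using risk_bounds[OF that] m by (simp add: h_eq that R_def field_simps)
    qed (simp add: h_zero)
    moreover have "\<bar>h m \<alpha> - h m \<beta>\<bar> \<le> (2 * b\<^sup>2 / a\<^sup>2 + 2 * \<sigma>\<^sup>2 / a ^ 3) * \<bar>\<alpha> - \<beta>\<bar>"
      if "0 < a" "a \<le> \<alpha>" "a \<le> \<beta>" for a m \<alpha> \<beta>
    proof (cases "m = 0")
      case False
      then have m: "1 \<le> m" by simp
      interpret spectral_bounds m "\<sigma>\<^sup>2" b "\<gamma> m" "X m" by (rule bounds[OF m])
      have "\<bar>h m \<alpha> - h m \<beta>\<bar> = \<bar>R m \<alpha> - R m \<beta>\<bar> / real m"
        using that m by (simp add: h_eq diff_divide_distrib[symmetric])
      also have "\<dots> \<le> real m * (2 * b\<^sup>2 / a\<^sup>2 + 2 * \<sigma>\<^sup>2 / a ^ 3) * \<bar>\<alpha> - \<beta>\<bar> / real m"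
        unfolding R_def by (intro divide_right_mono risk_lipschitz that) auto
      finally show ?thesis using m by simp
    qed (use that in \<open>simp add: h_zero\<close>)
    ultimately obtain r f where "strict_mono (r :: nat \<Rightarrow> nat)" "continuous_on {0<..} f"
      "\<And>C1 C2. 0 < C1 \<Longrightarrow> uniform_limit {C1..C2} (\<lambda>k. h (r k)) f sequentially"
      by (rule locally_lipschitz_convergent_subsequence[of h "b\<^sup>2 + \<sigma>\<^sup>2" "\<lambda>a. 2 * b\<^sup>2 / a\<^sup>2 + 2 * \<sigma>\<^sup>2 / a ^ 3"]) blast+
    then show ?thesis unfolding asymptotic_risk_def h_def by blast
  qed
  have main: "(\<exists>s \<alpha>. strict_mono s \<and> is_arg_min f (\<lambda>\<alpha>. 0 < \<alpha>) \<alpha> \<and> (\<lambda>k. \<alpha>_mspe (r (s k))) \<longlonglongrightarrow> \<alpha>) \<and>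
      converges_in_prob_to_set (\<lambda>k. M (r k)) (\<lambda>k. \<alpha>_psure (r k)) {\<alpha>. is_arg_min f (\<lambda>\<alpha>. 0 < \<alpha>) \<alpha>}"
    if "asymptotic_risk (\<lambda>m. mspe (M m) (A m) (x m) (y m)) r f" for r f
  proof -
    have r: "strict_mono r" and f: "continuous_on {0<..} f"
      and ul: "\<And>C1 C2. 0 < C1 \<Longrightarrow> C1 < C2 \<Longrightarrow> uniform_limit {C1..C2} (\<lambda>k. h (r k)) f sequentially"
      using that unfolding asymptotic_risk_def h_def by auto
    \<comment> \<open>The first member of the subsequence may be 0, where nothing is
      assumed.\<close>
    have rk: "\<forall>\<^sub>F k in sequentially. 1 \<le> r k"
      using eventually_ge_at_top[of 1] by eventually_elim (use seq_suble[OF r] in \<open>meson order_trans\<close>)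
    have lim: "(\<lambda>k. h (r k) \<alpha>) \<longlonglongrightarrow> f \<alpha>" if "0 < \<alpha>" for \<alpha>
      using tendsto_uniform_limitI[OF ul[of \<alpha> "\<alpha> + 1"], of \<alpha>] that by simp
    have pos: "0 < p1" "0 < p2" using p C by auto
    \<comment> \<open>\<kappa>, \<open>p1\<close> and \<open>p2\<close> do not depend on the
      dimension, so \<open>hgap\<close> passes to f at each \<alpha> separately, including those
      outside the interval.\<close>
    have fgap: "\<exists>p\<in>{C1..C2}. f p + \<kappa> \<le> f \<alpha>" if "0 < \<alpha>" "\<alpha> \<le> C1 \<or> C2 \<le> \<alpha>" for \<alpha>
      using that(2)
    proof
      assume "\<alpha> \<le> C1"
      have "f p1 + \<kappa> \<le> f \<alpha>"
        by (rule tendsto_le[OF _ lim[OF that(1)] tendsto_add[OF lim[OF pos(1)] tendsto_const]])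
           (use rk hgap(1)[OF _ that(1) \<open>\<alpha> \<le> C1\<close>] in \<open>auto elim: eventually_mono\<close>)
      then show ?thesis using p by blast
    next
      assume "C2 \<le> \<alpha>"
      have "f p2 + \<kappa> \<le> f \<alpha>"
        by (rule tendsto_le[OF _ lim[OF that(1)] tendsto_add[OF lim[OF pos(2)] tendsto_const]])
           (use rk hgap(2)[OF _ that(1) \<open>C2 \<le> \<alpha>\<close>] in \<open>auto elim: eventually_mono\<close>)
      then show ?thesis using p by blast
    qed
    obtain z0 where z0: "z0 \<in> {C1..C2}" "is_arg_min f (\<lambda>\<alpha>. 0 < \<alpha>) z0"
      using coercive_limit_minimizer[OF C \<kappa> f fgap] .
    have mspe_loc: "\<alpha>_mspe m \<in> {C1..C2}" "\<And>\<beta>. 0 < \<beta> \<Longrightarrow> h m (\<alpha>_mspe m) \<le> h m \<beta>" if m: "1 \<le> m" for m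
    proof -
      have gap: "\<exists>q\<in>{C1..C2}. R m q + real m * \<kappa> \<le> R m \<alpha>" if "0 < \<alpha>" "\<alpha> \<le> C1 \<or> C2 \<le> \<alpha>" for \<alpha>
        using that Rgap[OF m that(1)] p by blast
      interpret coercive C1 C2 "real m * \<kappa>" "R m"
      proof
        show "0 < real m * \<kappa>" using \<kappa> m by simp
        show "continuous_on {C1..C2} (R m)" "\<exists>L. (R m \<longlongrightarrow> L) (at_right 0)"
          unfolding R_def by (rule continuous_on_spectral(1)[OF C(1)] spectral_tendsto_zero(1))+
      qed (fact C gap)+
      have "is_arg_min (ext_zero (R m)) (\<lambda>\<alpha>. 0 \<le> \<alpha>) (\<alpha>_mspe m)"
        using mspe_min[OF m] unfolding is_arg_min_linorder by (auto simp: mspe_eq[OF m])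
      note a = arg_min_in_interval[OF this]
      show "\<alpha>_mspe m \<in> {C1..C2}" using a by simp
      show "h m (\<alpha>_mspe m) \<le> h m \<beta>" if "0 < \<beta>" for \<beta>
        using a(1) a(3)[OF that] C m that by (simp add: h_eq divide_right_mono)
    qed
    have "\<forall>\<^sub>F k in sequentially. \<alpha>_mspe (r k) \<in> {C1..C2} \<and> (\<forall>\<beta>>0. h (r k) (\<alpha>_mspe (r k)) \<le> h (r k) \<beta>)"
      using rk by eventually_elim (use mspe_loc in auto)
    from minimizers_converge[OF C(1) f ul this]
    have mspe_part: "\<exists>s \<alpha>. strict_mono s \<and> is_arg_min f (\<lambda>\<alpha>. 0 < \<alpha>) \<alpha> \<and> (\<lambda>k. \<alpha>_mspe (r (s k))) \<longlonglongrightarrow> \<alpha>"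
      by metis
    let ?S = "{\<alpha>. is_arg_min f (\<lambda>\<alpha>. 0 < \<alpha>) \<alpha>}"
    have psure_part: "(\<lambda>k. measure (M (r k)) {\<omega> \<in> space (M (r k)). \<forall>a\<in>?S. \<delta> \<le> \<bar>\<alpha>_psure (r k) \<omega> - a\<bar>}) \<longlonglongrightarrow> 0"
      if \<delta>: "0 < \<delta>" for \<delta>
    proof -
      \<comment> \<open>The set to be avoided also contains the two ends. There the gap \<kappa> is
        available although the convergence to f is not uniform.\<close>
      define far where "far \<alpha> \<longleftrightarrow> \<alpha> \<le> C1 \<or> C2 \<le> \<alpha> \<or> (\<forall>a\<in>?S. \<delta> \<le> \<bar>\<alpha> - a\<bar>)" for \<alpha>
      have "\<forall>\<^sub>F k in sequentially. \<forall>\<alpha>>0. \<alpha> \<le> C1 \<or> C2 \<le> \<alpha> \<longrightarrow> (\<exists>p\<in>{C1..C2}. h (r k) p + \<kappa> \<le> h (r k) \<alpha>)"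
        using rk by eventually_elim (use hgap p in blast)
      from uniform_gap_away_from_minimizers[OF C \<kappa> f z0 ul[OF C] this \<delta>]
      obtain \<eta> where \<eta>: "0 < \<eta>" and "\<forall>\<^sub>F k in sequentially. \<forall>\<alpha>>0. far \<alpha> \<longrightarrow> (\<exists>p\<in>{C1..C2}. h (r k) p + \<eta> \<le> h (r k) \<alpha>)"
        unfolding far_def by blast
      note gap = this(2)
      define K where "K = b\<^sup>2 + \<sigma>\<^sup>2"
      have K: "0 < K" using \<open>0 < \<sigma>\<^sup>2\<close> by (simp add: K_def add_nonneg_pos)
      \<comment> \<open>N depends on \<eta> only. Since K bounds the mean of a squared data
        coefficient, a grid cell of about m/N indices carries mean mass at most
        \<open>m * \<eta> / 32\<close>.\<close>
      define N where "N = nat \<lceil>32 * K / \<eta>\<rceil>"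
      have N: "32 * K / \<eta> \<le> real N" unfolding N_def by linarith
      have "0 < 32 * K / \<eta>" using K \<eta> by simp
      then have "0 < N" using N by linarith
      define Q where "Q = real (N + 1) * ((4 * (\<sigma>\<^sup>2)\<^sup>2 + 8 * \<sigma>\<^sup>2 * b\<^sup>2) * 256 / \<eta>\<^sup>2)"
      have bound: "measure (M m) {\<omega> \<in> space (M m). \<forall>a\<in>?S. \<delta> \<le> \<bar>\<alpha>_psure m \<omega> - a\<bar>} \<le> Q / real m"
        if m: "1 \<le> m" and big: "32 * K / \<eta> \<le> real m"
          and hg: "\<forall>\<alpha>>0. far \<alpha> \<longrightarrow> (\<exists>p\<in>{C1..C2}. h m p + \<eta> \<le> h m \<alpha>)" for m
      proof -
        interpret isotropic_noise "M m" m "\<sigma>\<^sup>2" "\<lambda>i \<omega>. col (U m) i \<bullet> \<epsilon> m \<omega>"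
          by (rule gaussian_noise_isotropic[OF prob[OF m] sigma_pos noise[OF m] singular_system_facts(1)[OF svd[OF m]]])
        interpret spectral_bounds m "\<sigma>\<^sup>2" b "\<gamma> m" "X m" by (rule bounds[OF m])
        \<comment> \<open>Rounded up, so that N cells cover all m indices. The extra index costs K,
          which \<open>big\<close> bounds by another \<open>m * \<eta> / 32\<close>.\<close>
        define L where "L = m div N + 1"
        have mNL: "m \<le> N * L"
          using dividend_less_times_div[OF \<open>0 < N\<close>, of m] by (simp add: L_def algebra_simps)
        have KL: "K * real L \<le> real m * \<eta> / 16"
        proof -
          have "real (m div N) * real N \<le> real m" by (metis div_times_less_eq_dividend of_nat_le_iff of_nat_mult)
          then have "real (m div N) * (32 * K / \<eta>) \<le> real m"
            using mult_left_mono[OF N, of "real (m div N)"] by linarith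
          then have "real (m div N) * K \<le> real m * \<eta> / 32" "K \<le> real m * \<eta> / 32"
            using \<eta> big by (simp_all add: field_simps)
          then show ?thesis by (simp add: L_def algebra_simps)
        qed
        have t: "0 < real m * \<eta> / 16" using m \<eta> by simp
        have cb: "\<bar>\<gamma> m i * X m i\<bar> \<le> b" if "i < m" for i
        proof -
          have "\<bar>\<gamma> m i\<bar> * \<bar>X m i\<bar> \<le> 1 * b" using g[OF that] x[OF that] by (intro mult_mono) auto
          then show ?thesis by (simp add: abs_mult)
        qed
        obtain E where E: "E \<in> events"
          "prob E \<le> real (N + 1) * ((4 * (\<sigma>\<^sup>2)\<^sup>2 + 8 * \<sigma>\<^sup>2 * b\<^sup>2) * real m / (real m * \<eta> / 16)\<^sup>2)"
          and dev: "\<And>\<omega> k. \<omega> \<in> space (M m) - E \<Longrightarrow> k \<le> m \<Longrightarrow>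
            \<bar>\<Sum>i<k. (\<gamma> m i * X m i + col (U m) i \<bullet> \<epsilon> m \<omega>)\<^sup>2 - ((\<gamma> m i * X m i)\<^sup>2 + \<sigma>\<^sup>2)\<bar> \<le> real m * \<eta> / 16 + (b\<^sup>2 + \<sigma>\<^sup>2) * real L"
          using max_deviation_event[of "\<lambda>i. \<gamma> m i * X m i" b N L "real m * \<eta> / 16"] cb mNL t by auto
        \<comment> \<open>Off the bad event the estimator has a minimizer, so the premise of the
          selection hypothesis is met and \<open>\<alpha>_psure m \<omega>\<close> is such a
          minimizer.\<close>
        have good: "\<not> far (\<alpha>_psure m \<omega>)" if \<omega>: "\<omega> \<in> space (M m) - E"
          and min: "(\<exists>\<alpha>. is_arg_min (psure (A m) \<sigma> (y m \<omega>)) (\<lambda>\<alpha>. 0 \<le> \<alpha>) \<alpha>) \<longrightarrow>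
            is_arg_min (psure (A m) \<sigma> (y m \<omega>)) (\<lambda>\<alpha>. 0 \<le> \<alpha>) (\<alpha>_psure m \<omega>)" for \<omega>
        proof -
          have e: "\<epsilon> m \<omega> \<in> carrier_vec m" using noise[OF m] \<omega> by (simp add: gaussian_noise_def)
          have yeq: "y m \<omega> = A m *\<^sub>v x m + \<epsilon> m \<omega>" using model[OF m] \<omega> by simp
          have yc: "y m \<omega> \<in> carrier_vec m"
            unfolding yeq using e singular_system_facts(5)[OF svd[OF m]] x_dim[OF m] by auto
          define Y where "Y i = col (U m) i \<bullet> y m \<omega>" for i
          have Y: "Y i = \<gamma> m i * X m i + col (U m) i \<bullet> \<epsilon> m \<omega>" if "i < m" for i
            unfolding Y_def yeq X_def by (rule col_data[OF svd[OF m] x_dim[OF m] e that])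
          have D: "\<bar>\<Sum>i<k. (Y i)\<^sup>2 - ((\<gamma> m i * X m i)\<^sup>2 + \<sigma>\<^sup>2)\<bar> \<le> real m * \<eta> / 8" if "k \<le> m" for k
          proof -
            have "(\<Sum>i<k. (Y i)\<^sup>2 - ((\<gamma> m i * X m i)\<^sup>2 + \<sigma>\<^sup>2))
              = (\<Sum>i<k. (\<gamma> m i * X m i + col (U m) i \<bullet> \<epsilon> m \<omega>)\<^sup>2 - ((\<gamma> m i * X m i)\<^sup>2 + \<sigma>\<^sup>2))"
              using that by (intro sum.cong) (auto simp: Y)
            then show ?thesis using dev[OF \<omega> that] KL by (simp add: K_def)
          qed
          have sd: "\<bar>spectral_sure m (\<sigma>\<^sup>2) (\<gamma> m) Y \<alpha> - spectral_risk m (\<sigma>\<^sup>2) (\<gamma> m) (X m) \<alpha>\<bar> \<le> 2 * (real m * \<eta> / 8)"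
            if "0 < \<alpha>" for \<alpha>
            by (rule sure_risk_uniform_deviation[OF _ _ D that]) (use \<gamma>[OF m] in auto)
          have rg: "\<exists>p\<in>{C1..C2}. spectral_risk m (\<sigma>\<^sup>2) (\<gamma> m) (X m) p + real m * \<eta> \<le> spectral_risk m (\<sigma>\<^sup>2) (\<gamma> m) (X m) \<alpha>"
            if "0 < \<alpha>" "far \<alpha>" for \<alpha>
          proof -
            have "\<exists>p\<in>{C1..C2}. h m p + \<eta> \<le> h m \<alpha>" using hg that by blast
            then obtain p where p: "p \<in> {C1..C2}" "h m p + \<eta> \<le> h m \<alpha>" by blast
            then have "R m p / real m + \<eta> \<le> R m \<alpha> / real m" using h_eq[OF m] that C by simp
            then have "real m * (R m p / real m + \<eta>) \<le> real m * (R m \<alpha> / real m)"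
              by (rule mult_left_mono) simp
            then have "R m p + real m * \<eta> \<le> R m \<alpha>" using m by (simp add: distrib_left)
            then show ?thesis using p(1) unfolding R_def by blast
          qed
          have fr: "\<alpha> \<le> C1 \<or> C2 \<le> \<alpha> \<Longrightarrow> far \<alpha>" for \<alpha> by (auto simp: far_def)
          \<comment> \<open>The error budget: \<open>m * \<eta> / 16\<close> each for the Chebyshev
            level and for the grid cell, doubled by Abel summation and doubled again by comparing
            two points, leaves \<open>m * \<eta> / 2\<close>, which is below the gap
            \<open>m * \<eta>\<close>.\<close>
          have lt: "2 * (2 * (real m * \<eta> / 8)) < real m * \<eta>" using t by linarith
          note loc = sure_minimizer_location[where far=far and m=m and s="\<sigma>\<^sup>2" and g="\<gamma> m" and x="X m" and Y=Y, OF C _ _ _ lt]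
          have ex: "\<exists>\<alpha>. is_arg_min (ext_zero (spectral_sure m (\<sigma>\<^sup>2) (\<gamma> m) Y)) (\<lambda>\<alpha>. 0 \<le> \<alpha>) \<alpha>"
            by (rule loc(1)) (fact fr rg sd)+
          have nf: "\<not> far \<alpha>" if "is_arg_min (ext_zero (spectral_sure m (\<sigma>\<^sup>2) (\<gamma> m) Y)) (\<lambda>\<alpha>. 0 \<le> \<alpha>) \<alpha>" for \<alpha>
            by (rule loc(2)) (fact fr rg sd that)+
          have eq: "is_arg_min (psure (A m) \<sigma> (y m \<omega>)) (\<lambda>\<alpha>. 0 \<le> \<alpha>) \<alpha>
            \<longleftrightarrow> is_arg_min (ext_zero (spectral_sure m (\<sigma>\<^sup>2) (\<gamma> m) Y)) (\<lambda>\<alpha>. 0 \<le> \<alpha>) \<alpha>" for \<alpha>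
            unfolding Y_def by (intro is_arg_min_cong psure_svd[OF svd[OF m] yc])
          show ?thesis using ex nf min unfolding eq by blast
        qed
        have "prob {\<omega> \<in> space (M m). \<forall>a\<in>?S. \<delta> \<le> \<bar>\<alpha>_psure m \<omega> - a\<bar>} \<le> prob E"
        proof (rule finite_measure_mono_AE[OF _ E(1)])
          show "AE \<omega> in M m. \<omega> \<in> {\<omega> \<in> space (M m). \<forall>a\<in>?S. \<delta> \<le> \<bar>\<alpha>_psure m \<omega> - a\<bar>} \<longrightarrow> \<omega> \<in> E"
            using psure_min[OF m] by eventually_elim (use good in \<open>auto simp: far_def\<close>)
        qed
        also have "\<dots> \<le> Q / real m"
        proof -
          \<comment> \<open>The Chebyshev level grows like m and the variance like m, which leaves
            one factor 1/m; 256 is the square of 16.\<close>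
          have "g * real m / (real m * \<eta> / 16)\<^sup>2 = g * 256 / \<eta>\<^sup>2 / real m" for g
            using m \<eta> by (simp add: field_simps power2_eq_square)
          then show ?thesis using E(2) by (simp add: Q_def)
        qed
        finally show ?thesis .
      qed
      have "\<forall>\<^sub>F k in sequentially. nat \<lceil>32 * K / \<eta>\<rceil> \<le> r k"
        using eventually_ge_at_top[of "nat \<lceil>32 * K / \<eta>\<rceil>"]
        by eventually_elim (use seq_suble[OF r] in \<open>meson order_trans\<close>)
      then have big: "\<forall>\<^sub>F k in sequentially. 32 * K / \<eta> \<le> real (r k)"
        by eventually_elim linarith
      show ?thesis
      proof (rule tendsto_sandwich[OF _ _ tendsto_const])
        show "\<forall>\<^sub>F k in sequentially. measure (M (r k)) {\<omega> \<in> space (M (r k)). \<forall>a\<in>?S. \<delta> \<le> \<bar>\<alpha>_psure (r k) \<omega> - a\<bar>} \<le> Q / real (r k)"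
          using rk big gap by eventually_elim (rule bound)
        show "(\<lambda>k. Q / real (r k)) \<longlonglongrightarrow> 0"
          by (intro tendsto_divide_0[OF tendsto_const] filterlim_at_top_imp_at_infinity
              filterlim_compose[OF filterlim_real_sequentially] filterlim_subseq r)
      qed simp
    qed
    show ?thesis using mspe_part psure_part unfolding converges_in_prob_to_set_def by blast
  qed
  show ?thesis using ex main by blast
qed

end
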